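(* Let $U\subset\mathbb{C}^n$ be open and let $H \subset U$ be a (possibly singular) real-analytic hypersurface, closed in $U$, that is curve-supported from two sides at $p \in H$. Then for any compact neighborhood $K \subset H$ of $p$ in $H$, the polynomial hull $\hat{K}$ and the rational hull $\hat{K}_{\mathrm{rat}}$ are neighborhoods of $p$ in $\mathbb{C}^n$ (that is, each contains an open subset of $\mathbb{C}^n$ containing $p$).
   Context: Real-analytic hypersurface: a set $H=\{z\in U:\rho(z,\bar z)=0\}$, where $\rho\colon U\to\mathbb{R}$ is real-analytic and $\dim H = 2n-1$ (the maximum of the dimensions at regular points). Singularities are allowed. Support curve: a holomorphic curve $C$ (one-dimensional complex analytic set defined near $p$) is a support curve for $H$ at $p$ if there is a neighborhood $W$ of $p$ with $C\cap W\cap H=\{p\}$. $H$ is curve-supported from two sides at $p$ if there are two support curves $C_1,C_2$ for $H$ at $p$ and a neighborhood $W$ of $p$ such that $(C_1\cap W)\setminus\{p\}$ and $(C_2\cap W)\setminus\{p\}$ lie in distinct connected components of $W\setminus H$. Hulls: for a compact set $K\subset\mathbb{C}^n$, the polynomial hull is $\hat K=\{z\in\mathbb{C}^n: |f(z)|\le\sup_{w\in K}|f(w)| \text{ for all holomorphic polynomials } f\}$, and the rational hull is $\hat K_{\mathrm{rat}}=\{z\in\mathbb{C}^n: f(z)\in f(K)\text{ for all holomorphic polynomials } f\}$. *)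

theory Defs
  imports "HOL-Analysis.Analysis"
begin

section \<open>Real-analytic hypersurfaces\<close>

text \<open>Multi-indices are functions from the standard basis to the naturals, undefined
  elsewhere. On \<^typ>\<open>complex ^ 'n\<close> the coordinates \<open>(x - a) \<bullet> b\<close> are the
  real and imaginary parts of the \<open>n\<close> complex coordinates, so this is analyticity in the
  \<open>2n\<close> underlying real variables.\<close>

definition real_analytic_at ::
    "('a::euclidean_space \<Rightarrow> 'b::euclidean_space) \<Rightarrow> 'a \<Rightarrow> bool" where
  "real_analytic_at f a \<longleftrightarrow>
    (\<exists>c N. open N \<and> a \<in> N \<and>
      (\<forall>x\<in>N. ((\<lambda>\<alpha>. (\<Prod>b\<in>Basis. ((x - a) \<bullet> b) ^ \<alpha> b) *\<^sub>R c \<alpha>)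
                has_sum f x) (Basis \<rightarrow>\<^sub>E (UNIV :: nat set))))"

definition real_analytic_on ::
    "('a::euclidean_space \<Rightarrow> 'b::euclidean_space) \<Rightarrow> 'a set \<Rightarrow> bool" where
  "real_analytic_on f S \<longleftrightarrow> (\<forall>a\<in>S. real_analytic_at f a)"

text \<open>\<open>A\<close> is near \<open>q\<close> a real-analytic submanifold of dimension \<open>d\<close>: a real-analytic
  diffeomorphism \<open>\<Phi>\<close> with inverse \<open>\<Psi>\<close> straightens it to a linear subspace.\<close>

definition real_regular_point :: "'a::euclidean_space set \<Rightarrow> nat \<Rightarrow> 'a \<Rightarrow> bool" where
  "real_regular_point A d q \<longleftrightarrow> q \<in> A \<and>
    (\<exists>N (\<Phi> :: 'a \<Rightarrow> 'a) (\<Psi> :: 'a \<Rightarrow> 'a) S.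
      open N \<and> q \<in> N \<and> open (\<Phi> ` N) \<and>
      real_analytic_on \<Phi> N \<and> real_analytic_on \<Psi> (\<Phi> ` N) \<and> (\<forall>z\<in>N. \<Psi> (\<Phi> z) = z) \<and>
      subspace S \<and> dim S = d \<and> \<Phi> ` (A \<inter> N) = S \<inter> \<Phi> ` N)"

definition real_analytic_hypersurface ::
    "(complex ^ 'n::finite) set \<Rightarrow> (complex ^ 'n) set \<Rightarrow> bool" where
  "real_analytic_hypersurface U H \<longleftrightarrow>
    (\<exists>\<rho> :: complex ^ 'n \<Rightarrow> real. real_analytic_on \<rho> U \<and> H = {z \<in> U. \<rho> z = 0}) \<and>
    (\<exists>q. real_regular_point H (2 * CARD('n) - 1) q) \<and>
    (\<forall>d q. real_regular_point H d q \<longrightarrow> d \<le> 2 * CARD('n) - 1)"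


section \<open>Complex analytic sets and support curves\<close>

text \<open>Used for open \<open>S\<close> only: the real Frechet derivative exists and is complex linear.\<close>

definition holomorphic_fun_on ::
    "(complex ^ 'n::finite \<Rightarrow> complex) \<Rightarrow> (complex ^ 'n) set \<Rightarrow> bool" where
  "holomorphic_fun_on f S \<longleftrightarrow>
    (\<forall>z\<in>S. \<exists>D. (f has_derivative D) (at z) \<and> (\<forall>c v. D (c *s v) = c * D v))"

definition holomorphic_map_on ::
    "(complex ^ 'n::finite \<Rightarrow> complex ^ 'm::finite) \<Rightarrow> (complex ^ 'n) set \<Rightarrow> bool" where
  "holomorphic_map_on F S \<longleftrightarrow> (\<forall>i. holomorphic_fun_on (\<lambda>z. F z $ i) S)"

definition complex_analytic_subset ::
    "(complex ^ 'n::finite) set \<Rightarrow> (complex ^ 'n) set \<Rightarrow> bool" where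
  "complex_analytic_subset A V \<longleftrightarrow> A \<subseteq> V \<and>
    (\<forall>q\<in>V. \<exists>N F. open N \<and> q \<in> N \<and> N \<subseteq> V \<and> finite F \<and>
      (\<forall>f\<in>F. holomorphic_fun_on f N) \<and> A \<inter> N = {z \<in> N. \<forall>f\<in>F. f z = 0})"

text \<open>Here \<open>vec.subspace\<close> and \<open>vec.dim\<close> are the complex-linear notions.\<close>

definition complex_regular_point ::
    "(complex ^ 'n::finite) set \<Rightarrow> nat \<Rightarrow> complex ^ 'n \<Rightarrow> bool" where
  "complex_regular_point A d q \<longleftrightarrow> q \<in> A \<and>
    (\<exists>N (\<Phi> :: complex ^ 'n \<Rightarrow> complex ^ 'n) (\<Psi> :: complex ^ 'n \<Rightarrow> complex ^ 'n) S.
      open N \<and> q \<in> N \<and> open (\<Phi> ` N) \<and>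
      holomorphic_map_on \<Phi> N \<and> holomorphic_map_on \<Psi> (\<Phi> ` N) \<and> (\<forall>z\<in>N. \<Psi> (\<Phi> z) = z) \<and>
      vec.subspace S \<and> vec.dim S = d \<and> \<Phi> ` (A \<inter> N) = S \<inter> \<Phi> ` N)"

text \<open>The dimension of \<open>A\<close> at \<open>p\<close> is the largest \<open>d\<close> such that regular points of dimension
  \<open>d\<close> accumulate at (or include) \<open>p\<close>.\<close>

definition complex_dim_at ::
    "(complex ^ 'n::finite) set \<Rightarrow> complex ^ 'n \<Rightarrow> nat \<Rightarrow> bool" where
  "complex_dim_at A p d \<longleftrightarrow>
    p \<in> closure {q. complex_regular_point A d q} \<and>
    (\<forall>d'>d. p \<notin> closure {q. complex_regular_point A d' q})"

text \<open>The dimension is required to be one at \<open>p\<close> itself. A bound on the regular points of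
  \<open>C\<close> alone would let \<open>p\<close> be an isolated point of \<open>C\<close>, and then being on one side of
  a hypersurface near \<open>p\<close> would be an empty condition.\<close>

definition holomorphic_curve_near ::
    "(complex ^ 'n::finite) set \<Rightarrow> complex ^ 'n \<Rightarrow> bool" where
  "holomorphic_curve_near C p \<longleftrightarrow>
    (\<exists>V. open V \<and> p \<in> V \<and> complex_analytic_subset C V) \<and> complex_dim_at C p 1"

text \<open>A neighborhood of \<open>p\<close> is any set with \<open>p\<close> in its interior.\<close>

definition support_curve ::
    "(complex ^ 'n::finite) set \<Rightarrow> (complex ^ 'n) set \<Rightarrow> complex ^ 'n \<Rightarrow> bool" where
  "support_curve C H p \<longleftrightarrow>
    holomorphic_curve_near C p \<and> (\<exists>W. p \<in> interior W \<and> C \<inter> W \<inter> H = {p})"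

definition curve_supported_from_two_sides ::
    "(complex ^ 'n::finite) set \<Rightarrow> complex ^ 'n \<Rightarrow> bool" where
  "curve_supported_from_two_sides H p \<longleftrightarrow>
    (\<exists>C\<^sub>1 C\<^sub>2. support_curve C\<^sub>1 H p \<and> support_curve C\<^sub>2 H p \<and>
      (\<exists>W. p \<in> interior W \<and>
        (\<exists>\<Omega>\<^sub>1 \<in> components (W - H). \<exists>\<Omega>\<^sub>2 \<in> components (W - H).
          \<Omega>\<^sub>1 \<noteq> \<Omega>\<^sub>2 \<and> C\<^sub>1 \<inter> W - {p} \<subseteq> \<Omega>\<^sub>1 \<and> C\<^sub>2 \<inter> W - {p} \<subseteq> \<Omega>\<^sub>2)))"


section \<open>Hulls\<close>

definition holomorphic_polynomial :: "(complex ^ 'n::finite \<Rightarrow> complex) \<Rightarrow> bool" where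
  "holomorphic_polynomial f \<longleftrightarrow>
    (\<exists>(A :: ('n \<Rightarrow> nat) set) c. finite A \<and>
      f = (\<lambda>z. \<Sum>\<alpha>\<in>A. c \<alpha> * (\<Prod>i\<in>UNIV. (z $ i) ^ \<alpha> i)))"

text \<open>The supremum is a genuine one for nonempty compact \<open>K\<close>.\<close>

definition polynomial_hull :: "(complex ^ 'n::finite) set \<Rightarrow> (complex ^ 'n) set" where
  "polynomial_hull K =
    {z. \<forall>f. holomorphic_polynomial f \<longrightarrow> cmod (f z) \<le> (SUP w\<in>K. cmod (f w))}"

definition rational_hull :: "(complex ^ 'n::finite) set \<Rightarrow> (complex ^ 'n) set" where
  "rational_hull K = {z. \<forall>f. holomorphic_polynomial f \<longrightarrow> f z \<in> f ` K}"

end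

theory Submission
  imports Defs "HOL-Complex_Analysis.Complex_Analysis" "HOL-Real_Asymp.Real_Asymp"
begin

text \<open>
  Every point of the rational hull is a point of the polynomial hull, so let \<open>f\<close> be a polynomial
  without zeros on \<open>H\<close> near \<open>p\<close>; its zeros in a small ball must be excluded uniformly in \<open>f\<close>.
  Let \<open>C\<close> be one of the support curves and \<open>\<Omega>\<close> its side, and consider for small \<open>w\<close> the zeros of
  \<open>f\<close> on \<open>C + w\<close> outside \<open>\<Omega>\<close>. They stay away from \<open>H\<close> and from the boundary of \<open>C + w\<close>, which
  lies in \<open>\<Omega>\<close>. Their existence is a closed condition on \<open>w\<close>; it is also open, since
  \<open>1/f\<close> obeys the maximum principle on \<open>C + w\<close> and so cannot be large there without a pole.
  There are none at \<open>w = 0\<close>, hence none for any small \<open>w\<close>, and every zero of \<open>f\<close> near \<open>p\<close> lies in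
  \<open>\<Omega>\<close>. With curves on two different sides there are no zeros near \<open>p\<close>.

  The maximum principle is needed on a possibly singular curve. It holds on the perfect kernel of any
  analytic set, by induction on the number of coordinates that do not vanish on the
  set in a suitable holomorphic chart. Either the set contains the whole coordinate slice and the
  one-variable principle applies, or some function \<open>f\<close> vanishing on the set has a derivative \<open>h\<close>
  along the slice that does not; then \<open>f\<close> is a new coordinate where \<open>h \<noteq> 0\<close>, and the set \<open>h = 0\<close> is
  negligible because large powers of a function dominate the factor \<open>h\<close>.
\<close>

section \<open>Holomorphic functions of several variables\<close>

lemma norm_vector_scalar_mult: "norm (c *s (v :: complex ^ 'n::finite)) = cmod c * norm v"
  by (simp add: norm_vec_def norm_mult L2_set_right_distrib)

lemma scaleR_eq_vector_scalar_mult: "r *\<^sub>R (v :: complex ^ 'n::finite) = of_real r *s v"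
  by (simp add: vec_eq_iff complex_eq_iff)

lemma holomorphic_fun_onI:
  assumes "\<And>z. z \<in> S \<Longrightarrow> (f has_derivative D z) (at z)"
    and "\<And>z c v. z \<in> S \<Longrightarrow> D z (c *s v) = c * D z v"
  shows "holomorphic_fun_on f S"
  using assms unfolding holomorphic_fun_on_def by blast

lemma holomorphic_fun_onD:
  assumes "holomorphic_fun_on f S" "z \<in> S"
  shows "(f has_derivative frechet_derivative f (at z)) (at z)"
    and "frechet_derivative f (at z) (c *s v) = c * frechet_derivative f (at z) v"
proof -
  obtain D where D: "(f has_derivative D) (at z)" "\<And>c v. D (c *s v) = c * D v"
    using assms unfolding holomorphic_fun_on_def by blast
  have "D = frechet_derivative f (at z)" using frechet_derivative_at[OF D(1)] .
  with D show "(f has_derivative frechet_derivative f (at z)) (at z)"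
    "frechet_derivative f (at z) (c *s v) = c * frechet_derivative f (at z) v" by auto
qed

lemma holomorphic_fun_on_subset:
  "holomorphic_fun_on f S \<Longrightarrow> T \<subseteq> S \<Longrightarrow> holomorphic_fun_on f T"
  unfolding holomorphic_fun_on_def by blast

lemma holomorphic_fun_on_imp_continuous_on:
  assumes "holomorphic_fun_on f S" shows "continuous_on S f"
  using assms holomorphic_fun_onD(1) has_derivative_continuous
  by (metis continuous_at_imp_continuous_on)

lemma holomorphic_fun_on_const: "holomorphic_fun_on (\<lambda>z. k) S"
  by (rule holomorphic_fun_onI[where D = "\<lambda>z v. 0"]) auto

lemma holomorphic_fun_on_component: "holomorphic_fun_on (\<lambda>z. z $ i) S"
  by (rule holomorphic_fun_onI[where D = "\<lambda>z v. v $ i"])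
     (auto intro!: bounded_linear_imp_has_derivative)

lemma holomorphic_fun_on_add:
  assumes "holomorphic_fun_on f S" "holomorphic_fun_on g S"
  shows "holomorphic_fun_on (\<lambda>z. f z + g z) S"
  by (rule holomorphic_fun_onI[OF has_derivative_add[OF holomorphic_fun_onD(1)[OF assms(1)]
        holomorphic_fun_onD(1)[OF assms(2)]]])
     (simp_all add: holomorphic_fun_onD(2)[OF assms(1)] holomorphic_fun_onD(2)[OF assms(2)] algebra_simps)

lemma holomorphic_fun_on_mult:
  assumes "holomorphic_fun_on f S" "holomorphic_fun_on g S"
  shows "holomorphic_fun_on (\<lambda>z. f z * g z) S"
  by (rule holomorphic_fun_onI[OF has_derivative_mult[OF holomorphic_fun_onD(1)[OF assms(1)]
        holomorphic_fun_onD(1)[OF assms(2)]]])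
     (simp_all add: holomorphic_fun_onD(2)[OF assms(1)] holomorphic_fun_onD(2)[OF assms(2)] algebra_simps)

lemma holomorphic_fun_on_diff:
  assumes "holomorphic_fun_on f S" "holomorphic_fun_on g S"
  shows "holomorphic_fun_on (\<lambda>z. f z - g z) S"
  using holomorphic_fun_on_add[OF assms(1)
      holomorphic_fun_on_mult[OF holomorphic_fun_on_const[of "-1"] assms(2)]] by simp

lemma holomorphic_fun_on_power:
  assumes "holomorphic_fun_on f S"
  shows "holomorphic_fun_on (\<lambda>z. f z ^ m) S"
  by (induction m) (simp_all add: holomorphic_fun_on_const holomorphic_fun_on_mult assms)

lemma holomorphic_fun_on_sum:
  assumes "\<And>i. i \<in> I \<Longrightarrow> holomorphic_fun_on (f i) S"
  shows "holomorphic_fun_on (\<lambda>z. \<Sum>i\<in>I. f i z) S"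
  using assms
  by (induction I rule: infinite_finite_induct)
     (simp_all add: holomorphic_fun_on_const holomorphic_fun_on_add)

lemma holomorphic_fun_on_prod:
  assumes "\<And>i. i \<in> I \<Longrightarrow> holomorphic_fun_on (f i) S"
  shows "holomorphic_fun_on (\<lambda>z. \<Prod>i\<in>I. f i z) S"
  using assms
  by (induction I rule: infinite_finite_induct)
     (simp_all add: holomorphic_fun_on_const holomorphic_fun_on_mult)

lemma holomorphic_fun_on_compose_field:
  assumes f: "holomorphic_fun_on f S"
    and g: "\<And>z. z \<in> S \<Longrightarrow> g field_differentiable at (f z)"
  shows "holomorphic_fun_on (\<lambda>z. g (f z)) S"
proof (rule holomorphic_fun_onI)
  fix z assume z: "z \<in> S"
  have "(g has_derivative (*) (deriv g (f z))) (at (f z))"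
    using g[OF z] field_differentiable_derivI has_field_derivative_def by blast
  from diff_chain_at[OF holomorphic_fun_onD(1)[OF f z] this]
  show "((\<lambda>z. g (f z)) has_derivative (\<lambda>v. deriv g (f z) * frechet_derivative f (at z) v)) (at z)"
    by (simp add: o_def)
qed (simp add: holomorphic_fun_onD(2)[OF f] algebra_simps)

lemma holomorphic_fun_on_inverse:
  assumes "holomorphic_fun_on f S" "\<And>z. z \<in> S \<Longrightarrow> f z \<noteq> 0"
  shows "holomorphic_fun_on (\<lambda>z. inverse (f z)) S"
  by (rule holomorphic_fun_on_compose_field[OF assms(1)])
     (auto intro: field_differentiable_inverse simp: assms field_differentiable_ident)

lemma holomorphic_fun_on_exp:
  assumes "holomorphic_fun_on f S"
  shows "holomorphic_fun_on (\<lambda>z. exp (f z)) S"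
  by (rule holomorphic_fun_on_compose_field[OF assms]) (rule field_differentiable_within_exp)

lemma holomorphic_polynomial_imp_holomorphic_fun_on:
  assumes "holomorphic_polynomial f" shows "holomorphic_fun_on f S"
  using assms unfolding holomorphic_polynomial_def
  by (auto intro!: holomorphic_fun_on_sum holomorphic_fun_on_mult holomorphic_fun_on_const
      holomorphic_fun_on_prod holomorphic_fun_on_power holomorphic_fun_on_component)

lemma holomorphic_fun_on_translate:
  assumes "holomorphic_fun_on f ((\<lambda>z. z + w) ` S)"
  shows "holomorphic_fun_on (\<lambda>z. f (z + w)) S"
proof (rule holomorphic_fun_onI)
  fix z assume z: "z \<in> S"
  then have zw: "z + w \<in> (\<lambda>z. z + w) ` S" by blast
  have "((\<lambda>z. z + w) has_derivative (\<lambda>v. v)) (at z)"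
    by (auto intro!: derivative_eq_intros)
  from diff_chain_at[OF this holomorphic_fun_onD(1)[OF assms zw]]
  show "((\<lambda>z. f (z + w)) has_derivative frechet_derivative f (at (z + w))) (at z)"
    by (simp add: o_def)
  show "frechet_derivative f (at (z + w)) (c *s v) = c * frechet_derivative f (at (z + w)) v" for c v
    by (rule holomorphic_fun_onD(2)[OF assms zw])
qed

lemma has_field_derivative_along_line:
  fixes f :: "complex ^ 'n::finite \<Rightarrow> complex"
  assumes "(f has_derivative D) (at (z + t *s v))" "\<And>c v. D (c *s v) = c * D v"
  shows "((\<lambda>t. f (z + t *s v)) has_field_derivative D v) (at t)"
proof -
  have "((\<lambda>t. z + t *s v) has_derivative (\<lambda>s. s *s v)) (at t)"
  proof -
    have "bounded_linear (\<lambda>s. s *s v)"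
      by (rule bounded_linear_intro[where K = "norm v"])
         (simp_all add: norm_vector_scalar_mult vec_eq_iff distrib_right)
    then have "((\<lambda>s. s *s v) has_derivative (\<lambda>s. s *s v)) (at t)"
      by (rule bounded_linear_imp_has_derivative)
    then show ?thesis by (auto intro!: derivative_eq_intros)
  qed
  from diff_chain_at[OF this assms(1)] show ?thesis
    unfolding has_field_derivative_def o_def
    by (rule has_derivative_eq_rhs) (auto simp: assms(2) fun_eq_iff)
qed

lemma holomorphic_fun_on_deriv_along_line:
  assumes "holomorphic_fun_on f S" "z + t *s v \<in> S"
  shows "((\<lambda>t. f (z + t *s v)) has_field_derivative frechet_derivative f (at (z + t *s v)) v) (at t)"
  by (rule has_field_derivative_along_line[OF holomorphic_fun_onD[OF assms]])

lemma Cauchy_estimate_frechet: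
  assumes f: "holomorphic_fun_on f (ball z r)" and "0 < r"
    and M: "\<And>x. x \<in> ball z r \<Longrightarrow> cmod (f x) \<le> M"
  shows "cmod (frechet_derivative f (at z) v) \<le> 2 * M / r * norm v"
proof (cases "v = 0")
  case True
  interpret bounded_linear "frechet_derivative f (at z)"
    using has_derivative_bounded_linear[OF holomorphic_fun_onD(1)[OF f]] \<open>0 < r\<close> by simp
  show ?thesis using True by (simp add: zero)
next
  case False
  define \<rho> where "\<rho> = r / (2 * norm v)"
  have \<rho>: "\<rho> > 0" using False \<open>0 < r\<close> by (simp add: \<rho>_def)
  have inb: "z + t *s v \<in> ball z r" if "cmod t \<le> \<rho>" for t
  proof -
    have "cmod t * norm v \<le> \<rho> * norm v" using that by (simp add: mult_right_mono)
    also have "\<dots> = r / 2" using False by (simp add: \<rho>_def)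
    finally show ?thesis using \<open>0 < r\<close> by (simp add: dist_norm norm_vector_scalar_mult)
  qed
  have hol: "(\<lambda>t. f (z + t *s v)) holomorphic_on cball 0 \<rho>"
    unfolding holomorphic_on_def field_differentiable_def
    by (metis holomorphic_fun_on_deriv_along_line[OF f inb] mem_cball_0 has_field_derivative_at_within)
  have "norm ((deriv ^^ 1) (\<lambda>t. f (z + t *s v)) 0) \<le> fact 1 * M / \<rho> ^ 1"
  proof (rule Cauchy_inequality)
    show "(\<lambda>t. f (z + t *s v)) holomorphic_on ball 0 \<rho>"
      using hol holomorphic_on_subset ball_subset_cball by blast
    show "continuous_on (cball 0 \<rho>) (\<lambda>t. f (z + t *s v))"
      using hol holomorphic_on_imp_continuous_on by blast
  qed (use \<rho> M inb in auto)
  moreover have "deriv (\<lambda>t. f (z + t *s v)) 0 = frechet_derivative f (at z) v"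
    using DERIV_imp_deriv[OF holomorphic_fun_on_deriv_along_line[OF f, where t = 0]] \<open>0 < r\<close> by simp
  ultimately show ?thesis using False by (simp add: \<rho>_def field_simps)
qed

lemma holomorphic_fun_on_uniform_limit:
  fixes g :: "complex ^ 'n::finite \<Rightarrow> complex"
  assumes "open S" and f: "\<And>n. holomorphic_fun_on (f n) S"
    and lim: "uniform_limit S f g sequentially"
  shows "holomorphic_fun_on g S"
  unfolding holomorphic_fun_on_def
proof
  fix z assume "z \<in> S"
  then obtain r where r: "r > 0" "ball z (2 * r) \<subseteq> S"
    using \<open>open S\<close> open_contains_ball_eq
    by (metis field_sum_of_halves half_gt_zero mult_2)
  have sub: "ball x r \<subseteq> S" if "x \<in> ball z r" for x
    using r that by (smt (verit) ball_subset_ball_iff dist_commute mem_ball subset_trans)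
  define D where "D n x = frechet_derivative (f n) (at x)" for n x
  have D: "(f n has_derivative D n x) (at x)" and Dc: "D n x (c *s v) = c * D n x v"
    if "x \<in> S" for n x c v
    using holomorphic_fun_onD[OF f that] by (auto simp: D_def)
  have est: "cmod (D n x v - D m x v) \<le> 2 * M / r * norm v"
    if x: "x \<in> ball z r" and M: "\<And>y. y \<in> S \<Longrightarrow> cmod (f n y - f m y) \<le> M" for n m x v M
  proof -
    have h: "holomorphic_fun_on (\<lambda>y. f n y - f m y) (ball x r)"
      by (rule holomorphic_fun_on_diff) (use f sub[OF x] holomorphic_fun_on_subset in blast)+
    have xS: "x \<in> S" using sub[OF x] r(1) by auto
    have "((\<lambda>y. f n y - f m y) has_derivative (\<lambda>v. D n x v - D m x v)) (at x)"
      by (rule has_derivative_diff[OF D[OF xS] D[OF xS]])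
    then have "frechet_derivative (\<lambda>y. f n y - f m y) (at x) = (\<lambda>v. D n x v - D m x v)"
      by (simp add: frechet_derivative_at[symmetric])
    moreover have "cmod (frechet_derivative (\<lambda>y. f n y - f m y) (at x) v) \<le> 2 * M / r * norm v"
      by (rule Cauchy_estimate_frechet[OF h r(1)]) (use M sub[OF x] in blast)
    ultimately show ?thesis by simp
  qed
  have ucauchy: "\<exists>N. \<forall>n\<ge>N. \<forall>m\<ge>N. \<forall>x\<in>ball z r. \<forall>v. cmod (D n x v - D m x v) \<le> e * norm v"
    if "e > 0" for e
  proof -
    have "e * r / 4 > 0" using that r by simp
    then obtain N where N: "\<And>n x. n \<ge> N \<Longrightarrow> x \<in> S \<Longrightarrow> dist (f n x) (g x) < e * r / 4"
      using lim unfolding uniform_limit_sequentially_iff by blast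
    have "cmod (D n x v - D m x v) \<le> 2 * (e * r / 2) / r * norm v"
      if "n \<ge> N" "m \<ge> N" "x \<in> ball z r" for n m x v
    proof (rule est[OF that(3)])
      fix y assume "y \<in> S"
      have "dist (f n y) (f m y) \<le> dist (f n y) (g y) + dist (f m y) (g y)"
        by (rule dist_triangle2)
      also have "\<dots> \<le> e * r / 2"
        using N[OF that(1) \<open>y \<in> S\<close>] N[OF that(2) \<open>y \<in> S\<close>] by simp
      finally show "cmod (f n y - f m y) \<le> e * r / 2" by (simp add: dist_norm)
    qed
    then show ?thesis using r by (intro exI[of _ N]) auto
  qed
  define D' where "D' x v = lim (\<lambda>n. D n x v)" for x v
  have conv: "(\<lambda>n. D n x v) \<longlonglongrightarrow> D' x v" if x: "x \<in> ball z r" for x v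
  proof -
    have "Cauchy (\<lambda>n. D n x v)"
      unfolding Cauchy_def
    proof (intro allI impI)
      fix e :: real assume "e > 0"
      then have "e / (norm v + 1) > 0" by (simp add: add_nonneg_pos)
      from ucauchy[OF this] obtain N where N: "\<And>n m. n \<ge> N \<Longrightarrow> m \<ge> N \<Longrightarrow>
          cmod (D n x v - D m x v) \<le> e / (norm v + 1) * norm v" using x by blast
      have "norm v + 1 > 0" by (simp add: add_nonneg_pos)
      with \<open>e > 0\<close> have "e / (norm v + 1) * norm v < e" by (simp add: divide_simps)
      then show "\<exists>M. \<forall>m\<ge>M. \<forall>n\<ge>M. dist (D m x v) (D n x v) < e"
        using N unfolding dist_norm by (meson le_less_trans)
    qed
    then show ?thesis unfolding D'_def by (simp add: Cauchy_convergent_iff convergent_LIMSEQ_iff)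
  qed
  have nle: "\<forall>\<^sub>F n in sequentially. \<forall>x\<in>ball z r. \<forall>v. cmod (D n x v - D' x v) \<le> e * norm v"
    if "e > 0" for e
  proof -
    obtain N where N: "\<And>n m x v. n \<ge> N \<Longrightarrow> m \<ge> N \<Longrightarrow> x \<in> ball z r \<Longrightarrow>
        cmod (D n x v - D m x v) \<le> e * norm v" using ucauchy[OF \<open>e > 0\<close>] by blast
    have "cmod (D n x v - D' x v) \<le> e * norm v" if "n \<ge> N" "x \<in> ball z r" for n x v
    proof (rule LIMSEQ_le_const2)
      show "(\<lambda>m. cmod (D n x v - D m x v)) \<longlonglongrightarrow> cmod (D n x v - D' x v)"
        by (intro tendsto_intros conv that)
      show "\<exists>K. \<forall>m\<ge>K. cmod (D n x v - D m x v) \<le> e * norm v" using N that by blast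
    qed
    then show ?thesis unfolding eventually_sequentially by blast
  qed
  have pt: "(\<lambda>n. f n x) \<longlonglongrightarrow> g x" if "x \<in> S" for x
    using tendsto_uniform_limitI[OF lim that] .
  have zS: "z \<in> ball z r" using r by simp
  have bS: "x \<in> S" if "x \<in> ball z r" for x using sub[OF that] r(1) by auto
  obtain g1 where g1: "\<And>x. x \<in> ball z r \<Longrightarrow> (\<lambda>n. f n x) \<longlonglongrightarrow> g1 x"
      "\<And>x. x \<in> ball z r \<Longrightarrow> (g1 has_derivative D' x) (at x within ball z r)"
    using has_derivative_sequence[OF convex_ball has_derivative_at_withinI[OF D[OF bS]] nle zS
        pt[OF bS[OF zS]]] by blast
  have "g1 x = g x" if "x \<in> ball z r" for x
    using LIMSEQ_unique g1(1)[OF that] pt[OF bS[OF that]] by blast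
  then have "(g has_derivative D' z) (at z)"
    using has_derivative_transform_within_open[of g1 "D' z" z UNIV "ball z r" g] g1(2)[OF zS] zS
    by (simp add: at_within_open[OF zS])
  moreover have "D' z (c *s v) = c * D' z v" for c v
  proof (rule LIMSEQ_unique[OF conv[OF zS]])
    show "(\<lambda>n. D n z (c *s v)) \<longlonglongrightarrow> c * D' z v"
      unfolding Dc[OF \<open>z \<in> S\<close>] by (intro tendsto_intros conv zS)
  qed
  ultimately show "\<exists>D. (g has_derivative D) (at z) \<and> (\<forall>c v. D (c *s v) = c * D v)" by blast
qed

lemma holomorphic_fun_on_frechet_lipschitz:
  fixes f :: "complex ^ 'n::finite \<Rightarrow> complex"
  assumes f: "holomorphic_fun_on f S" and "open S" "z \<in> S"
  obtains r C where "r > 0" "C \<ge> 0" "ball z r \<subseteq> S"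
    "\<And>x y v. x \<in> ball z r \<Longrightarrow> y \<in> ball z r \<Longrightarrow>
      cmod (frechet_derivative f (at x) v - frechet_derivative f (at y) v) \<le> C * dist x y * norm v"
proof -
  have "isCont f z" using holomorphic_fun_onD(1)[OF f \<open>z \<in> S\<close>] has_derivative_continuous by blast
  then obtain d where d: "d > 0" "\<And>x. dist x z < d \<Longrightarrow> dist (f x) (f z) < 1"
    unfolding continuous_at_eps_delta by (metis zero_less_one)
  obtain e where e: "e > 0" "ball z e \<subseteq> S" using assms open_contains_ball_eq by blast
  define r where "r = min d e / 4"
  define M where "M = cmod (f z) + 1"
  have r: "r > 0" using d e by (simp add: r_def)
  have sub: "ball z (4 * r) \<subseteq> S" using e(2) by (force simp: r_def)
  have M: "cmod (f x) \<le> M" if "x \<in> ball z (4 * r)" for x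
  proof -
    have "dist (f x) (f z) < 1" using that by (intro d(2)) (simp add: r_def dist_commute)
    then show ?thesis unfolding M_def dist_norm by (smt (verit) norm_triangle_sub)
  qed
  define L where "L = 2 * M / r"
  have L: "L \<ge> 0" using r by (simp add: L_def M_def)
  let ?D = "\<lambda>x. frechet_derivative f (at x)"
  have D: "cmod (?D x v) \<le> L * norm v" if "x \<in> ball z (3 * r)" for x v
    unfolding L_def
  proof (rule Cauchy_estimate_frechet[OF _ r])
    have "ball x r \<subseteq> ball z (4 * r)" using that by (simp add: ball_subset_ball_iff dist_commute)
    then show "holomorphic_fun_on f (ball x r)" "\<And>y. y \<in> ball x r \<Longrightarrow> cmod (f y) \<le> M"
      using M sub holomorphic_fun_on_subset[OF f] by auto
  qed
  have lip: "cmod (f x - f y) \<le> L * norm (x - y)" if "x \<in> ball z (3 * r)" "y \<in> ball z (3 * r)" for x y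
  proof (rule differentiable_bound[OF convex_ball _ _ that])
    fix u assume u: "u \<in> ball z (3 * r)"
    then have "u \<in> S" using sub r by force
    then show "(f has_derivative ?D u) (at u within ball z (3 * r))"
      using holomorphic_fun_onD(1)[OF f] has_derivative_at_withinI by blast
    show "onorm (?D u) \<le> L" by (rule onorm_bound[OF L D[OF u]])
  qed
  show ?thesis
  proof (rule that[of r "2 * L / r"])
    fix x y v assume x: "x \<in> ball z r" and y: "y \<in> ball z r"
    let ?k = "\<lambda>u. f (u + (x - y)) - f u"
    have t1: "u \<in> ball z (3 * r)" if "u \<in> ball y r" for u
      using that y dist_triangle[of z u y] r by (simp add: dist_commute)
    have t2: "u + (x - y) \<in> ball z (3 * r)" if "u \<in> ball y r" for u
    proof -
      have "dist x (u + (x - y)) = dist y u" by (simp add: dist_norm)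
      then show ?thesis using that x dist_triangle[of z "u + (x - y)" x] r by (simp add: dist_commute)
    qed
    have s3: "ball z (3 * r) \<subseteq> S" using sub r by force
    have k: "holomorphic_fun_on ?k (ball y r)"
    proof (rule holomorphic_fun_on_diff)
      show "holomorphic_fun_on (\<lambda>u. f (u + (x - y))) (ball y r)"
        by (rule holomorphic_fun_on_translate, rule holomorphic_fun_on_subset[OF f]) (use t2 s3 in auto)
      show "holomorphic_fun_on f (ball y r)"
        by (rule holomorphic_fun_on_subset[OF f]) (use t1 s3 in auto)
    qed
    have "cmod (frechet_derivative ?k (at y) v) \<le> 2 * (L * norm (x - y)) / r * norm v"
    proof (rule Cauchy_estimate_frechet[OF k r])
      fix u assume "u \<in> ball y r"
      from lip[OF t2[OF this] t1[OF this]] show "cmod (?k u) \<le> L * norm (x - y)" by simp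
    qed
    moreover have "(?k has_derivative (\<lambda>v. ?D x v - ?D y v)) (at y)"
    proof (rule has_derivative_diff)
      have "x \<in> S" "y \<in> S" using x y sub r by force+
      then show "(f has_derivative ?D y) (at y)" using holomorphic_fun_onD(1)[OF f] by blast
      have "((\<lambda>u. u + (x - y)) has_derivative (\<lambda>v. v)) (at y)"
        by (auto intro!: derivative_eq_intros)
      from diff_chain_at[OF this, of f "?D x"] holomorphic_fun_onD(1)[OF f \<open>x \<in> S\<close>]
      show "((\<lambda>u. f (u + (x - y))) has_derivative ?D x) (at y)" by (simp add: o_def)
    qed
    then have "frechet_derivative ?k (at y) = (\<lambda>v. ?D x v - ?D y v)"
      by (simp add: frechet_derivative_at[symmetric])
    ultimately show "cmod (?D x v - ?D y v) \<le> 2 * L / r * dist x y * norm v"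
      by (simp add: dist_norm mult_ac)
  qed (use r L sub in force)+
qed

lemma holomorphic_fun_on_directional_derivative:
  fixes f :: "complex ^ 'n::finite \<Rightarrow> complex"
  assumes f: "holomorphic_fun_on f S" and "open S"
  shows "holomorphic_fun_on (\<lambda>z. frechet_derivative f (at z) v) S"
  unfolding holomorphic_fun_on_def
proof
  fix z assume z: "z \<in> S"
  let ?D = "\<lambda>x. frechet_derivative f (at x)"
  obtain r C where r: "r > 0" "C \<ge> 0" "ball z r \<subseteq> S"
    and lip: "\<And>x y v. x \<in> ball z r \<Longrightarrow> y \<in> ball z r \<Longrightarrow> cmod (?D x v - ?D y v) \<le> C * dist x y * norm v"
    using holomorphic_fun_on_frechet_lipschitz[OF f \<open>open S\<close> z] by blast
  define c where "c = r / 2 / (norm v + 1)"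
  have c: "c > 0" "c * norm v < r / 2"
  proof -
    have "norm v + 1 > 0" by (simp add: add_nonneg_pos)
    with r(1) show "c > 0" "c * norm v < r / 2" by (simp_all add: c_def divide_simps)
  qed
  define s where "s n = c / (real n + 1)" for n
  have s: "s n > 0" "s n \<le> c" for n using c by (auto simp: s_def field_simps add_nonneg_pos)
  have s0: "s \<longlonglongrightarrow> 0" unfolding s_def by real_asymp
  have snv: "norm (s n *\<^sub>R v) < r / 2" for n
  proof -
    have "norm (s n *\<^sub>R v) \<le> c * norm v" using s[of n] by (simp add: mult_right_mono)
    then show ?thesis using c by simp
  qed
  have shift: "x + t *\<^sub>R (s n *\<^sub>R v) \<in> ball z r" if "x \<in> ball z (r / 2)" "t \<in> {0..1}" for x n t
  proof -
    have "norm (t *\<^sub>R u) \<le> norm u" for u :: "complex ^ 'n"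
      using that by (simp add: mult_left_le_one_le)
    then have "norm (t *\<^sub>R (s n *\<^sub>R v)) \<le> norm (s n *\<^sub>R v)" .
    then have "dist x (x + t *\<^sub>R (s n *\<^sub>R v)) < r / 2" using snv[of n] by (simp add: dist_norm)
    then show ?thesis using that(1) dist_triangle[of z "x + t *\<^sub>R (s n *\<^sub>R v)" x] by simp
  qed
  define q where "q n x = (f (x + s n *\<^sub>R v) - f x) * of_real (1 / s n)" for n x
  have qest: "cmod (q n x - ?D x v) \<le> C * (norm v)\<^sup>2 * s n" if x: "x \<in> ball z (r / 2)" for n x
  proof -
    let ?T = "(\<lambda>t. x + t *\<^sub>R (s n *\<^sub>R v)) ` {0..1}"
    have T: "u \<in> ball z r" if "u \<in> ?T" for u using that shift[OF x] by blast
    have xT: "x \<in> ?T" by (auto intro!: image_eqI[of _ _ 0])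
    have "norm (f (x + s n *\<^sub>R v) - f x - ?D x ((x + s n *\<^sub>R v) - x)) \<le>
        norm ((x + s n *\<^sub>R v) - x) * (C * (s n * norm v))"
    proof (rule differentiable_bound_linearization[where S = ?T and f' = ?D])
      show "x + t *\<^sub>R ((x + s n *\<^sub>R v) - x) \<in> ?T" if "t \<in> {0..1}" for t using that by auto
      show "(f has_derivative ?D u) (at u within ?T)" if "u \<in> ?T" for u
        using holomorphic_fun_onD(1)[OF f] T[OF that] r(3) has_derivative_at_withinI by blast
      show "onorm (?D u - ?D x) \<le> C * (s n * norm v)" if uT: "u \<in> ?T" for u
      proof (rule onorm_bound)
        show "0 \<le> C * (s n * norm v)" using r s[of n] by simp
        fix y :: "complex ^ 'n"
        have "dist u x \<le> s n * norm v"
        proof -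
          obtain t where t: "t \<in> {0..1}" "u = x + t *\<^sub>R (s n *\<^sub>R v)" using uT by blast
          then have "dist u x = t * (s n * norm v)" using s[of n] by (simp add: dist_norm)
          also have "\<dots> \<le> 1 * (s n * norm v)"
            by (rule mult_right_mono) (use t s[of n] in auto)
          finally show ?thesis by simp
        qed
        then have "C * dist u x * norm y \<le> C * (s n * norm v) * norm y"
          using r by (intro mult_right_mono mult_left_mono) auto
        moreover have "cmod (?D u y - ?D x y) \<le> C * dist u x * norm y"
          by (rule lip[OF T[OF uT] T[OF xT]])
        ultimately show "norm ((?D u - ?D x) y) \<le> C * (s n * norm v) * norm y"
          unfolding minus_apply by (rule order_trans[rotated])
      qed
    qed (rule xT)
    then have "cmod (f (x + s n *\<^sub>R v) - f x - of_real (s n) * ?D x v) \<le> s n * (C * (norm v)\<^sup>2 * s n)"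
    proof -
      have "?D x (s n *\<^sub>R v) = of_real (s n) * ?D x v"
        unfolding scaleR_eq_vector_scalar_mult using holomorphic_fun_onD(2)[OF f] T[OF xT] r(3) by blast
      moreover assume "norm (f (x + s n *\<^sub>R v) - f x - ?D x ((x + s n *\<^sub>R v) - x)) \<le>
        norm ((x + s n *\<^sub>R v) - x) * (C * (s n * norm v))"
      ultimately show ?thesis using s[of n] by (simp add: power2_eq_square mult_ac)
    qed
    moreover have "f (x + s n *\<^sub>R v) - f x - of_real (s n) * ?D x v = of_real (s n) * (q n x - ?D x v)"
      using s[of n] by (simp add: q_def field_simps)
    ultimately have "s n * cmod (q n x - ?D x v) \<le> s n * (C * (norm v)\<^sup>2 * s n)"
      using s[of n] by (simp add: norm_mult)
    then show ?thesis using s[of n] by simp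
  qed
  have "holomorphic_fun_on (\<lambda>z. ?D z v) (ball z (r / 2))"
  proof (rule holomorphic_fun_on_uniform_limit)
    show "holomorphic_fun_on (q n) (ball z (r / 2))" for n
      unfolding q_def
    proof (rule holomorphic_fun_on_mult[OF holomorphic_fun_on_diff holomorphic_fun_on_const])
      show "holomorphic_fun_on (\<lambda>x. f (x + s n *\<^sub>R v)) (ball z (r / 2))"
        by (rule holomorphic_fun_on_translate, rule holomorphic_fun_on_subset[OF f])
           (use shift[of _ 1 n] r(3) in auto)
      show "holomorphic_fun_on f (ball z (r / 2))"
        by (rule holomorphic_fun_on_subset[OF f]) (use r(1,3) in force)
    qed
    show "uniform_limit (ball z (r / 2)) q (\<lambda>z. ?D z v) sequentially"
      unfolding uniform_limit_iff
    proof (intro allI impI)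
      fix e :: real assume "e > 0"
      have "(\<lambda>n. C * (norm v)\<^sup>2 * s n) \<longlonglongrightarrow> C * (norm v)\<^sup>2 * 0"
        by (intro tendsto_intros s0)
      then have "\<forall>\<^sub>F n in sequentially. C * (norm v)\<^sup>2 * s n < e"
        using order_tendstoD(2)[of _ 0 sequentially e] \<open>e > 0\<close> by simp
      then show "\<forall>\<^sub>F n in sequentially. \<forall>x\<in>ball z (r / 2). dist (q n x) (?D x v) < e"
      proof eventually_elim
        case (elim n)
        show ?case
        proof
          fix x assume "x \<in> ball z (r / 2)"
          from le_less_trans[OF qest[OF this] elim] show "dist (q n x) (?D x v) < e"
            by (simp add: dist_norm)
        qed
      qed
    qed
  qed auto
  then show "\<exists>D. ((\<lambda>z. ?D z v) has_derivative D) (at z) \<and> (\<forall>c v. D (c *s v) = c * D v)"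
    using r(1) unfolding holomorphic_fun_on_def by simp
qed

definition jac :: "(complex ^ 'n::finite \<Rightarrow> complex ^ 'm::finite) \<Rightarrow> complex ^ 'n \<Rightarrow> complex ^ 'n \<Rightarrow> complex ^ 'm"
  where "jac \<Phi> z v = (\<chi> i. frechet_derivative (\<lambda>z. \<Phi> z $ i) (at z) v)"

lemma has_derivative_vecI:
  fixes f :: "'a::real_normed_vector \<Rightarrow> 'b::euclidean_space ^ 'm::finite"
  assumes "\<And>i. ((\<lambda>z. f z $ i) has_derivative (\<lambda>v. D v $ i)) (at z)"
  shows "(f has_derivative D) (at z)"
  unfolding has_derivative_componentwise_within[of f]
  by (auto simp: Basis_vec_def inner_axis intro!: has_derivative_inner_left assms)

lemma holomorphic_map_onD:
  assumes "holomorphic_map_on \<Phi> S" "z \<in> S"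
  shows "(\<Phi> has_derivative jac \<Phi> z) (at z)" "jac \<Phi> z (c *s v) = c *s jac \<Phi> z v"
proof -
  have h: "holomorphic_fun_on (\<lambda>z. \<Phi> z $ i) S" for i
    using assms unfolding holomorphic_map_on_def by blast
  show "(\<Phi> has_derivative jac \<Phi> z) (at z)"
    by (rule has_derivative_vecI) (simp add: jac_def holomorphic_fun_onD(1)[OF h assms(2)])
  show "jac \<Phi> z (c *s v) = c *s jac \<Phi> z v"
    by (simp add: jac_def vec_eq_iff holomorphic_fun_onD(2)[OF h assms(2)])
qed

lemma holomorphic_map_onI:
  assumes "\<And>z. z \<in> S \<Longrightarrow> (\<Phi> has_derivative D z) (at z)"
    and "\<And>z c v. z \<in> S \<Longrightarrow> D z (c *s v) = c *s D z v"
  shows "holomorphic_map_on \<Phi> S"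
  unfolding holomorphic_map_on_def
proof
  fix i
  show "holomorphic_fun_on (\<lambda>z. \<Phi> z $ i) S"
    by (rule holomorphic_fun_onI[where D = "\<lambda>z v. D z v $ i"])
       (auto simp: assms(2) intro: bounded_linear.has_derivative[OF bounded_linear_vec_nth assms(1)])
qed

lemma holomorphic_map_on_subset:
  "holomorphic_map_on \<Phi> S \<Longrightarrow> T \<subseteq> S \<Longrightarrow> holomorphic_map_on \<Phi> T"
  unfolding holomorphic_map_on_def using holomorphic_fun_on_subset by blast

lemma holomorphic_map_on_imp_continuous_on:
  "holomorphic_map_on \<Phi> S \<Longrightarrow> continuous_on S \<Phi>"
  by (metis continuous_at_imp_continuous_on has_derivative_continuous holomorphic_map_onD(1))

lemma frechet_derivative_compose_holomorphic_map:
  assumes "holomorphic_fun_on f T" "holomorphic_map_on \<Phi> S" "z \<in> S" "\<Phi> z \<in> T"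
  shows "((\<lambda>z. f (\<Phi> z)) has_derivative (\<lambda>v. frechet_derivative f (at (\<Phi> z)) (jac \<Phi> z v))) (at z)"
  using diff_chain_at[OF holomorphic_map_onD(1)[OF assms(2,3)] holomorphic_fun_onD(1)[OF assms(1,4)]]
  by (simp add: o_def)

lemma holomorphic_fun_on_compose_map:
  assumes "holomorphic_fun_on f T" "holomorphic_map_on \<Phi> S" "\<And>z. z \<in> S \<Longrightarrow> \<Phi> z \<in> T"
  shows "holomorphic_fun_on (\<lambda>z. f (\<Phi> z)) S"
  by (rule holomorphic_fun_onI[OF frechet_derivative_compose_holomorphic_map[OF assms(1,2) _ assms(3)]])
     (auto simp: holomorphic_map_onD(2)[OF assms(2)] holomorphic_fun_onD(2)[OF assms(1) assms(3)])

lemma holomorphic_inverse_function: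
  fixes \<Phi> :: "complex ^ 'n::finite \<Rightarrow> complex ^ 'n"
  assumes \<Phi>: "holomorphic_map_on \<Phi> U" and "open U" "q \<in> U"
    and inj: "\<And>v. jac \<Phi> q v = 0 \<Longrightarrow> v = 0"
  obtains U' V \<Psi> where "open U'" "U' \<subseteq> U" "q \<in> U'" "open V" "homeomorphism U' V \<Phi> \<Psi>"
    "holomorphic_map_on \<Psi> V" "\<And>z v. z \<in> U' \<Longrightarrow> jac \<Phi> z v = 0 \<Longrightarrow> v = 0"
proof -
  define B where "B z = Blinfun (jac \<Phi> z)" for z
  have B: "blinfun_apply (B z) = jac \<Phi> z" if "z \<in> U" for z
    unfolding B_def using holomorphic_map_onD(1)[OF \<Phi> that]
    by (intro bounded_linear_Blinfun_apply) (rule has_derivative_bounded_linear)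
  have cont: "continuous_on U B"
  proof (rule continuous_on_blinfun_componentwise)
    fix v :: "complex ^ 'n"
    have "continuous_on U (\<lambda>z. jac \<Phi> z v)"
      unfolding jac_def
    proof (rule continuous_on_vec_lambda)
      fix i
      show "continuous_on U (\<lambda>z. frechet_derivative (\<lambda>z. \<Phi> z $ i) (at z) v)"
        using \<Phi> \<open>open U\<close> unfolding holomorphic_map_on_def
        by (intro holomorphic_fun_on_imp_continuous_on holomorphic_fun_on_directional_derivative) auto
    qed
    then show "continuous_on U (\<lambda>z. blinfun_apply (B z) v)"
      by (rule continuous_on_eq) (simp add: B)
  qed
  have lin: "linear (jac \<Phi> q)"
    using has_derivative_linear holomorphic_map_onD(1)[OF \<Phi> \<open>q \<in> U\<close>] by blast
  then have "inj (jac \<Phi> q)" using inj linear_injective_0 by blast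
  then obtain g where g: "linear g" "g \<circ> jac \<Phi> q = id"
    using linear_injective_left_inverse[OF lin] by blast
  have invB: "Blinfun g o\<^sub>L B q = id_blinfun"
    using g B[OF \<open>q \<in> U\<close>]
    by (intro blinfun_eqI) (simp add: bounded_linear_Blinfun_apply linear_conv_bounded_linear fun_eq_iff)
  have derB: "(\<Phi> has_derivative blinfun_apply (B z)) (at z)" if "z \<in> U" for z
    using holomorphic_map_onD(1)[OF \<Phi> that] B[OF that] by simp
  obtain U' V \<Psi> \<Psi>' where *: "open U'" "U' \<subseteq> U" "q \<in> U'" "open V" "homeomorphism U' V \<Phi> \<Psi>"
    and \<Psi>': "\<And>y. y \<in> V \<Longrightarrow> (\<Psi> has_derivative \<Psi>' y) (at y)"
      "\<And>y. y \<in> V \<Longrightarrow> \<Psi>' y = inv (blinfun_apply (B (\<Psi> y)))"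
      "\<And>y. y \<in> V \<Longrightarrow> bij (blinfun_apply (B (\<Psi> y)))"
    by (rule inverse_function_theorem[OF \<open>open U\<close> derB cont \<open>q \<in> U\<close> invB]) (assumption, rule that)
  have \<Psi>U: "\<Psi> y \<in> U'" if "y \<in> V" for y
    using * that homeomorphism_image2 by blast
  have bij: "bij (jac \<Phi> (\<Psi> y))" and \<Psi>'eq: "\<Psi>' y = inv (jac \<Phi> (\<Psi> y))" if "y \<in> V" for y
    using \<Psi>'(2,3)[OF that] B \<Psi>U[OF that] *(2) by (auto simp: subset_iff)
  show ?thesis
  proof (rule that[OF *])
    show "holomorphic_map_on \<Psi> V"
    proof (rule holomorphic_map_onI[OF \<Psi>'(1)])
      fix y c v assume y: "y \<in> V"
      let ?J = "jac \<Phi> (\<Psi> y)"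
      have "?J (c *s \<Psi>' y v) = c *s v"
        using holomorphic_map_onD(2)[OF \<Phi>, of "\<Psi> y"] \<Psi>U[OF y] *(2)
        by (simp add: subset_iff \<Psi>'eq[OF y] surj_f_inv_f bij_is_surj[OF bij[OF y]])
      then show "\<Psi>' y (c *s v) = c *s \<Psi>' y v"
        by (metis \<Psi>'eq[OF y] bij[OF y] bij_is_inj inv_f_f)
    qed
    fix z v assume z: "z \<in> U'" "jac \<Phi> z v = 0"
    then have "\<Phi> z \<in> V" "\<Psi> (\<Phi> z) = z"
      using *(5) homeomorphism_apply1 homeomorphism_image1 by blast+
    then have "inj (jac \<Phi> z)" using bij bij_is_inj by metis
    moreover have "linear (jac \<Phi> z)"
      using has_derivative_linear holomorphic_map_onD(1)[OF \<Phi>] z(1) *(2) by blast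
    ultimately show "v = 0" using z(2) linear_injective_0 by blast
  qed
qed

section \<open>Local peak points and the maximum principle on analytic sets\<close>

definition peak_at :: "(complex ^ 'n::finite) set \<Rightarrow> complex ^ 'n \<Rightarrow> bool" where
  "peak_at A q \<longleftrightarrow> (\<exists>N G. open N \<and> q \<in> N \<and> holomorphic_fun_on G N \<and>
     (\<forall>z \<in> A \<inter> N - {q}. cmod (G z) < cmod (G q)))"

lemma perturbed_maximum:
  fixes u :: "'a::real_normed_vector \<Rightarrow> real"
  assumes "compact X" "continuous_on X u" "a \<in> X" "0 \<le> s" "s < u a"
    and Y: "\<And>y. y \<in> X \<inter> Y \<Longrightarrow> u y \<le> s"
  obtains \<epsilon> x where "\<epsilon> > 0" "x \<in> X" "x \<notin> Y" "u x > 0"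
    "\<And>y. y \<in> X \<Longrightarrow> u y * exp (\<epsilon> * (norm y)\<^sup>2) \<le> u x * exp (\<epsilon> * (norm x)\<^sup>2)"
proof -
  obtain R where R: "\<And>y. y \<in> X \<Longrightarrow> norm y \<le> R"
    using compact_imp_bounded[OF assms(1)] bounded_iff by blast
  have "((\<lambda>\<epsilon>. s * exp (\<epsilon> * R\<^sup>2)) \<longlongrightarrow> s * exp (0 * R\<^sup>2)) (at_right 0)"
    by (intro tendsto_intros)
  then have "\<forall>\<^sub>F \<epsilon> in at_right 0. s * exp (\<epsilon> * R\<^sup>2) < u a"
    using order_tendstoD(2)[of _ s "at_right 0" "u a"] assms by simp
  then have "\<exists>\<epsilon>>0. s * exp (\<epsilon> * R\<^sup>2) < u a"
    unfolding eventually_at_right_field by (metis dense)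
  then obtain \<epsilon> where \<epsilon>: "\<epsilon> > 0" "s * exp (\<epsilon> * R\<^sup>2) < u a" by blast
  let ?w = "\<lambda>y. u y * exp (\<epsilon> * (norm y)\<^sup>2)"
  have "continuous_on X ?w" by (intro continuous_intros assms)
  then obtain x where x: "x \<in> X" "\<And>y. y \<in> X \<Longrightarrow> ?w y \<le> ?w x"
    using continuous_attains_sup[OF assms(1)] \<open>a \<in> X\<close> by blast
  have "u a \<le> ?w a" using \<epsilon> assms by simp
  then have wx: "u a \<le> ?w x" using x(2)[OF \<open>a \<in> X\<close>] by linarith
  then have "0 < ?w x" using assms by linarith
  then have pos: "u x > 0" by (simp add: zero_less_mult_iff)
  have "x \<notin> Y"
  proof
    assume "x \<in> Y"
    have "(norm x)\<^sup>2 \<le> R\<^sup>2" using R[OF x(1)] by (simp add: power_mono)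
    then have "?w x \<le> s * exp (\<epsilon> * R\<^sup>2)"
      using Y x(1) \<open>x \<in> Y\<close> \<epsilon>(1) assms(4) by (intro mult_mono) auto
    then show False using wx \<epsilon>(2) by linarith
  qed
  then show ?thesis using that \<epsilon>(1) x pos by blast
qed

lemma peak_at_perturbed_maximum:
  fixes x :: "complex ^ 'n::finite"
  assumes "open N" "x \<in> N" "holomorphic_fun_on G N" "G x \<noteq> 0" "\<epsilon> > 0"
    and max: "\<And>y. y \<in> A \<inter> N \<Longrightarrow>
      cmod (G y) * exp (\<epsilon> * (norm y)\<^sup>2) \<le> cmod (G x) * exp (\<epsilon> * (norm x)\<^sup>2)"
  shows "peak_at A x"
proof -
  text \<open>The modulus of \<open>exp (2 \<epsilon> lv)\<close> agrees with \<open>exp (\<epsilon> |z|\<^sup>2)\<close> up to a constant and the factor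
    \<open>exp (\<epsilon> |z - x|\<^sup>2)\<close>, which makes the maximum strict.\<close>
  define lv where "lv z = (\<Sum>i\<in>UNIV. (z $ i - x $ i) * cnj (x $ i))" for z
  have Re_lv: "Re (lv z) = (z - x) \<bullet> x" for z
    by (simp add: lv_def inner_vec_def inner_complex_def)
  define K where "K z = G z * exp (of_real (2 * \<epsilon>) * lv z)" for z
  have K: "holomorphic_fun_on K N"
    unfolding K_def lv_def
    by (rule holomorphic_fun_on_mult[OF assms(3) holomorphic_fun_on_exp[OF
          holomorphic_fun_on_mult[OF holomorphic_fun_on_const holomorphic_fun_on_sum]]],
        rule holomorphic_fun_on_mult[OF holomorphic_fun_on_diff[OF
          holomorphic_fun_on_component holomorphic_fun_on_const] holomorphic_fun_on_const])
  have cK: "cmod (K z) = (cmod (G z) * exp (\<epsilon> * (norm z)\<^sup>2)) * exp (- \<epsilon> * (norm x)\<^sup>2) *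
      exp (- \<epsilon> * (norm (z - x))\<^sup>2)" for z
  proof -
    have "(norm z)\<^sup>2 = (norm x)\<^sup>2 + 2 * ((z - x) \<bullet> x) + (norm (z - x))\<^sup>2"
      by (simp add: power2_norm_eq_inner inner_diff_left inner_diff_right inner_commute)
    then have "\<epsilon> * (norm z)\<^sup>2 = \<epsilon> * (norm x)\<^sup>2 + 2 * \<epsilon> * ((z - x) \<bullet> x) + \<epsilon> * (norm (z - x))\<^sup>2"
      by (simp only: distrib_left)
    then have "2 * \<epsilon> * Re (lv z) = \<epsilon> * (norm z)\<^sup>2 + - \<epsilon> * (norm x)\<^sup>2 + - \<epsilon> * (norm (z - x))\<^sup>2"
      by (simp add: Re_lv)
    moreover have "cmod (K z) = cmod (G z) * exp (2 * \<epsilon> * Re (lv z))"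
      by (simp add: K_def norm_mult)
    ultimately show ?thesis by (simp only: exp_add mult.assoc)
  qed
  have "cmod (K y) < cmod (K x)" if y: "y \<in> A \<inter> N - {x}" for y
  proof -
    have "exp (- \<epsilon> * (norm (y - x))\<^sup>2) < 1" using y \<open>\<epsilon> > 0\<close> by simp
    then have "cmod (K y) < (cmod (G x) * exp (\<epsilon> * (norm x)\<^sup>2)) * exp (- \<epsilon> * (norm x)\<^sup>2)" 
      if "G y \<noteq> 0"
    proof -
      have "cmod (K y) < (cmod (G y) * exp (\<epsilon> * (norm y)\<^sup>2)) * exp (- \<epsilon> * (norm x)\<^sup>2)"
        unfolding cK[of y]
        using mult_strict_left_mono[OF \<open>exp (- \<epsilon> * (norm (y - x))\<^sup>2) < 1\<close>,
            of "cmod (G y) * exp (\<epsilon> * (norm y)\<^sup>2) * exp (- \<epsilon> * (norm x)\<^sup>2)"] that by simp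
      also have "\<dots> \<le> (cmod (G x) * exp (\<epsilon> * (norm x)\<^sup>2)) * exp (- \<epsilon> * (norm x)\<^sup>2)"
        using max[of y] y by (intro mult_right_mono) auto
      finally show ?thesis .
    qed
    moreover have "cmod (K y) = 0" if "G y = 0" using that by (simp add: K_def)
    moreover have "cmod (K x) > 0" using \<open>G x \<noteq> 0\<close> by (simp add: K_def)
    ultimately show ?thesis using cK[of x] by (cases "G y = 0") auto
  qed
  then show ?thesis
    unfolding peak_at_def by (intro exI[of _ N] exI[of _ K] conjI ballI) (use assms(1,2) K in auto)
qed

lemma compact_Int_cball_relative:
  fixes q :: "'a::heine_borel"
  assumes "closedin (top_of_set N) A" "cball q r \<subseteq> N"
  shows "compact (A \<inter> cball q r)"
proof -
  obtain T where "closed T" "A = N \<inter> T" using assms(1) closedin_closed by blast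
  then have "A \<inter> cball q r = T \<inter> cball q r" using assms(2) by blast
  then show ?thesis using closed_Int_compact[OF \<open>closed T\<close> compact_cball] by simp
qed

lemma not_peak_at_if_dense:
  fixes q :: "complex ^ 'n::finite"
  assumes "open N" "closedin (top_of_set N) A" "q \<in> A"
    and "open W" "q \<in> W" and h: "holomorphic_fun_on h W"
    and dense: "\<And>e. e > 0 \<Longrightarrow> \<exists>x \<in> A \<inter> ball q e. h x \<noteq> 0"
    and np: "\<And>x. x \<in> A \<inter> W \<Longrightarrow> h x \<noteq> 0 \<Longrightarrow> \<not> peak_at A x"
  shows "\<not> peak_at A q"
proof (cases "h q = 0")
  case False
  then show ?thesis using np assms by blast
next
  case hq: True
  show ?thesis
  proof
    assume "peak_at A q"
    then obtain M G where M: "open M" "q \<in> M" "holomorphic_fun_on G M"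
      and peak: "\<And>z. z \<in> A \<inter> M - {q} \<Longrightarrow> cmod (G z) < cmod (G q)"
      unfolding peak_at_def by blast
    have "q \<in> N" using closedin_subset[OF assms(2)] assms(3) by auto
    have "open (N \<inter> W \<inter> M)" "q \<in> N \<inter> W \<inter> M" using assms M \<open>q \<in> N\<close> by auto
    then obtain r where r: "r > 0" "cball q r \<subseteq> N \<inter> W \<inter> M" using open_contains_cball by blast
    have bsub: "ball q r \<subseteq> N \<inter> W \<inter> M" using r(2) ball_subset_cball by blast
    define X where "X = A \<inter> cball q r"
    have "compact X"
      unfolding X_def by (rule compact_Int_cball_relative[OF assms(2)]) (use r in auto)
    have "X \<subseteq> M" "X \<subseteq> W" "q \<in> X" using r assms by (auto simp: X_def)
    have cG: "continuous_on X G" and ch: "continuous_on X h"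
      using holomorphic_fun_on_imp_continuous_on M h \<open>X \<subseteq> M\<close> \<open>X \<subseteq> W\<close> continuous_on_subset by blast+
    have "G q \<noteq> 0"
    proof -
      obtain x where "x \<in> A \<inter> ball q r" "h x \<noteq> 0" using dense r(1) by blast
      then have "cmod (G x) < cmod (G q)" using hq bsub by (intro peak) auto
      then show ?thesis by auto
    qed
    obtain s where s: "0 \<le> s" "s < cmod (G q)" "\<And>y. y \<in> X \<inter> sphere q r \<Longrightarrow> cmod (G y) \<le> s"
    proof (cases "X \<inter> sphere q r = {}")
      case True
      then show ?thesis using that[of 0] \<open>G q \<noteq> 0\<close> by simp
    next
      case False
      have "compact (X \<inter> sphere q r)" using \<open>compact X\<close> by (simp add: compact_Int)
      moreover have "continuous_on (X \<inter> sphere q r) (\<lambda>y. cmod (G y))"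
        by (intro continuous_intros continuous_on_subset[OF cG]) auto
      ultimately obtain b where b: "b \<in> X \<inter> sphere q r"
        "\<And>y. y \<in> X \<inter> sphere q r \<Longrightarrow> cmod (G y) \<le> cmod (G b)"
        using continuous_attains_sup[of "X \<inter> sphere q r" "\<lambda>y. cmod (G y)"] False by blast
      have "b \<in> A \<inter> M - {q}" using b(1) \<open>X \<subseteq> M\<close> r by (auto simp: X_def)
      then show ?thesis using that[of "cmod (G b)"] peak b by auto
    qed
    obtain H where H: "\<And>y. y \<in> X \<Longrightarrow> cmod (h y) \<le> H"
      using compact_continuous_image[OF ch \<open>compact X\<close>] compact_imp_bounded bounded_iff
      by (metis imageI)
    have "isCont (\<lambda>y. cmod (G y)) q"
      using holomorphic_fun_onD(1)[OF M(3,2)] has_derivative_continuous by (intro continuous_intros) blast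
    then have "\<forall>\<^sub>F y in at q. s < cmod (G y)" using order_tendstoD(1) s(2) isContD by blast
    then obtain d where d: "d > 0" "\<And>y. y \<noteq> q \<Longrightarrow> dist y q < d \<Longrightarrow> s < cmod (G y)"
      unfolding eventually_at by auto
    obtain a where a: "a \<in> A" "a \<in> ball q (min d r)" "h a \<noteq> 0" using dense[of "min d r"] d(1) r(1) by auto
    have aX: "a \<in> X" using a by (simp add: X_def)
    have sa: "s < cmod (G a)" using a d(2)[of a] hq by (auto simp: dist_commute)
    define t where "t = s / cmod (G a)"
    have Ga: "cmod (G a) > 0" using sa s(1) by linarith
    then have t: "0 \<le> t" "t < 1" using sa s(1) by (simp_all add: t_def)
    have "(\<lambda>m. t ^ m * H) \<longlonglongrightarrow> 0 * H" using t by (intro tendsto_intros LIMSEQ_power_zero) auto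
    then have "\<forall>\<^sub>F m in sequentially. t ^ m * H < cmod (h a)"
      using order_tendstoD(2)[of _ "0 * H" sequentially "cmod (h a)"] a(3) by simp
    then obtain m where "t ^ m * H < cmod (h a)" by (auto simp: eventually_sequentially)
    then have m: "s ^ m * H < cmod (G a) ^ m * cmod (h a)"
      using Ga by (simp add: t_def power_divide field_simps)
    define u where "u y = cmod (G y ^ m * h y)" for y
    obtain \<epsilon> x where x: "\<epsilon> > 0" "x \<in> X" "x \<notin> sphere q r" "u x > 0"
      "\<And>y. y \<in> X \<Longrightarrow> u y * exp (\<epsilon> * (norm y)\<^sup>2) \<le> u x * exp (\<epsilon> * (norm x)\<^sup>2)"
    proof (rule perturbed_maximum[OF \<open>compact X\<close>, of u a "s ^ m * H" "sphere q r"])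
      show "continuous_on X u" unfolding u_def by (intro continuous_intros cG ch)
      show "a \<in> X" by fact
      have "0 \<le> H" using H[OF aX] norm_ge_zero order_trans by blast
      then show "0 \<le> s ^ m * H" using s(1) by simp
      show "s ^ m * H < u a" using m by (simp add: u_def norm_mult norm_power)
      fix y assume y: "y \<in> X \<inter> sphere q r"
      show "u y \<le> s ^ m * H"
        unfolding u_def norm_mult norm_power using H s(1) s(3)[OF y] y
        by (intro mult_mono power_mono) auto
    qed blast
    have xb: "x \<in> ball q r" using x by (auto simp: X_def)
    have "peak_at A x"
    proof (rule peak_at_perturbed_maximum[where N = "ball q r" and G = "\<lambda>y. G y ^ m * h y"])
      show "holomorphic_fun_on (\<lambda>y. G y ^ m * h y) (ball q r)"
        by (rule holomorphic_fun_on_mult[OF holomorphic_fun_on_power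
              [OF holomorphic_fun_on_subset[OF M(3)]] holomorphic_fun_on_subset[OF h]]) (use bsub in auto)
      show "G x ^ m * h x \<noteq> 0" using x(4) by (simp add: u_def)
      show "cmod (G y ^ m * h y) * exp (\<epsilon> * (norm y)\<^sup>2) \<le> cmod (G x ^ m * h x) * exp (\<epsilon> * (norm x)\<^sup>2)"
        if "y \<in> A \<inter> ball q r" for y using x(5)[of y] that by (auto simp: u_def X_def)
    qed (use xb x in auto)
    moreover have "h x \<noteq> 0" using x(4) by (simp add: u_def)
    ultimately show False using np[of x] x(2) \<open>X \<subseteq> W\<close> by (auto simp: X_def)
  qed
qed

text \<open>Passing to the perfect kernel discards isolated points, at which every function peaks.
  It does so without showing that isolated points of an analytic set cannot accumulate.\<close>

definition perfect_kernel :: "'a::topological_space set \<Rightarrow> 'a set" where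
  "perfect_kernel C = \<Union>{T. T \<subseteq> C \<and> (\<forall>x\<in>T. x islimpt T)}"

lemma perfect_kernel_subset: "perfect_kernel C \<subseteq> C"
  by (auto simp: perfect_kernel_def)

lemma perfect_kernel_maximal: "T \<subseteq> C \<Longrightarrow> (\<And>x. x \<in> T \<Longrightarrow> x islimpt T) \<Longrightarrow> T \<subseteq> perfect_kernel C"
  by (auto simp: perfect_kernel_def)

lemma islimpt_perfect_kernel:
  assumes "x \<in> perfect_kernel C" shows "x islimpt perfect_kernel C"
proof -
  obtain T where T: "x \<in> T" "T \<subseteq> C" "\<And>x. x \<in> T \<Longrightarrow> x islimpt T"
    using assms unfolding perfect_kernel_def by blast
  show ?thesis by (rule islimpt_subset[OF T(3)[OF T(1)] perfect_kernel_maximal[OF T(2,3)]])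
qed

lemma closure_perfect_kernel_subset:
  fixes C :: "'a::t1_space set"
  assumes "closedin (top_of_set N) C"
  shows "N \<inter> closure (perfect_kernel C) \<subseteq> perfect_kernel C"
proof (rule perfect_kernel_maximal)
  obtain S where S: "closed S" "C = N \<inter> S" using assms closedin_closed by blast
  then show "N \<inter> closure (perfect_kernel C) \<subseteq> C"
    using closure_minimal[of "perfect_kernel C" S] perfect_kernel_subset[of C] by blast
  have CN: "perfect_kernel C \<subseteq> N \<inter> closure (perfect_kernel C)"
    using perfect_kernel_subset[of C] S closure_subset by blast
  fix x assume x: "x \<in> N \<inter> closure (perfect_kernel C)"
  have "x islimpt perfect_kernel C"
    using x islimpt_perfect_kernel by (auto simp: closure_def)
  then show "x islimpt N \<inter> closure (perfect_kernel C)" using CN islimpt_subset by blast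
qed

lemma closedin_perfect_kernel:
  fixes C :: "'a::t1_space set"
  assumes "closedin (top_of_set N) C"
  shows "closedin (top_of_set N) (perfect_kernel C)"
proof -
  have "perfect_kernel C = N \<inter> closure (perfect_kernel C)"
    using closure_perfect_kernel_subset[OF assms] closure_subset perfect_kernel_subset
      closedin_subset[OF assms] by fastforce
  then show ?thesis by (metis closed_closure closedin_closed_Int)
qed

lemma linear_eq_zero_on_axes:
  fixes D :: "complex ^ 'n::finite \<Rightarrow> complex"
  assumes "linear D" "\<And>c v. D (c *s v) = c * D v" "\<And>i. v $ i \<noteq> 0 \<Longrightarrow> D (axis i 1) = 0"
  shows "D v = 0"
proof -
  have "D v = D (\<Sum>i\<in>UNIV. (v $ i) *s axis i 1)" by (simp add: basis_expansion)
  also have "\<dots> = (\<Sum>i\<in>UNIV. D ((v $ i) *s axis i 1))" by (rule linear_sum[OF assms(1)])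
  also have "\<dots> = 0"
  proof (rule sum.neutral, rule ballI)
    fix i
    show "D ((v $ i) *s axis i 1) = 0"
      using assms(3)[of i] by (cases "v $ i = 0") (simp_all add: assms(2) linear_0[OF assms(1)])
  qed
  finally show ?thesis .
qed

lemma holomorphic_on_along_line:
  assumes "holomorphic_fun_on f S" "\<And>t. t \<in> T \<Longrightarrow> z + t *s v \<in> S"
  shows "(\<lambda>t. f (z + t *s v)) holomorphic_on T"
  unfolding holomorphic_on_def field_differentiable_def
  using holomorphic_fun_on_deriv_along_line[OF assms(1)] assms(2) has_field_derivative_at_within
  by blast

lemma homeomorphism_image_open:
  assumes "homeomorphism U' V \<Phi> \<Psi>" "open V" "open W" "W \<subseteq> U'"
  shows "open (\<Phi> ` W)" "\<Phi> ` W \<subseteq> V" "y \<in> \<Phi> ` W \<Longrightarrow> \<Psi> y \<in> W \<and> \<Phi> (\<Psi> y) = y"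
proof -
  have eq: "\<Phi> ` W = V \<inter> \<Psi> -` W"
  proof
    show "\<Phi> ` W \<subseteq> V \<inter> \<Psi> -` W"
      using assms(1,4) by (auto simp: homeomorphism_def subset_iff)
    show "V \<inter> \<Psi> -` W \<subseteq> \<Phi> ` W"
      using assms(1,4) by (auto simp: homeomorphism_def intro!: image_eqI)
  qed
  then show "\<Phi> ` W \<subseteq> V" "y \<in> \<Phi> ` W \<Longrightarrow> \<Psi> y \<in> W \<and> \<Phi> (\<Psi> y) = y"
    using assms(1,4) by (auto simp: homeomorphism_def)
  show "open (\<Phi> ` W)"
    unfolding eq using assms(1-3) continuous_open_preimage by (auto simp: homeomorphism_def)
qed

lemma vanish_on_ball_if_derivatives_vanish:
  fixes fs :: "nat \<Rightarrow> complex ^ 'n::finite \<Rightarrow> complex"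
  assumes hol: "\<And>k. holomorphic_fun_on (fs k) (ball y0 \<rho>)"
    and step: "\<And>k y. y \<in> ball y0 \<rho> \<Longrightarrow> fs (Suc k) y = frechet_derivative (fs k) (at y) v"
    and zero: "\<And>k. fs k y0 = 0" and v: "y0 + v \<in> ball y0 \<rho>"
  shows "fs 0 (y0 + v) = 0"
proof (cases "v = 0")
  case True
  then show ?thesis using zero by simp
next
  case False
  define R where "R = \<rho> / norm v"
  have inb: "y0 + t *s v \<in> ball y0 \<rho>" if "t \<in> ball 0 R" for t
    using that False by (simp add: R_def dist_norm norm_vector_scalar_mult field_simps)
  have "1 \<in> ball (0::complex) R" using v False by (simp add: R_def dist_norm field_simps)
  have der: "(deriv ^^ k) (\<lambda>t. fs 0 (y0 + t *s v)) t = fs k (y0 + t *s v)" if "t \<in> ball 0 R" for k t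
    using that
  proof (induction k arbitrary: t)
    case (Suc k)
    have "((\<lambda>t. fs k (y0 + t *s v)) has_field_derivative fs (Suc k) (y0 + t *s v)) (at t)"
      using holomorphic_fun_on_deriv_along_line[OF hol inb[OF Suc.prems]] step[OF inb[OF Suc.prems]]
      by simp
    then have "((deriv ^^ k) (\<lambda>t. fs 0 (y0 + t *s v)) has_field_derivative fs (Suc k) (y0 + t *s v)) (at t)"
      by (rule has_field_derivative_transform_within_open[OF _ open_ball Suc.prems]) (simp add: Suc.IH)
    then show ?case by (simp add: DERIV_imp_deriv)
  qed simp
  have R: "0 \<in> ball (0::complex) R" using \<open>1 \<in> ball 0 R\<close> by (simp add: less_trans[OF zero_less_one])
  have "(\<lambda>t. fs 0 (y0 + t *s v)) 1 = 0"
  proof (rule holomorphic_fun_eq_0_on_ball[OF _ \<open>1 \<in> ball 0 R\<close>])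
    show "(\<lambda>t. fs 0 (y0 + t *s v)) holomorphic_on ball 0 R"
      by (rule holomorphic_on_along_line[OF hol inb])
    show "(deriv ^^ k) (\<lambda>t. fs 0 (y0 + t *s v)) 0 = 0" for k
      using der[OF R, of k] zero by simp
  qed
  then show ?thesis by simp
qed

lemma not_peak_at_if_contains_slice:
  fixes \<Psi> :: "complex ^ 'm::finite \<Rightarrow> complex ^ 'n::finite"
  assumes "open V" "y \<in> V" and \<Psi>: "holomorphic_map_on \<Psi> V" and inj: "inj_on \<Psi> V" and "v \<noteq> 0"
    and sub: "\<And>t. y + t *s v \<in> V \<Longrightarrow> \<Psi> (y + t *s v) \<in> A"
  shows "\<not> peak_at A (\<Psi> y)"
proof
  assume "peak_at A (\<Psi> y)"
  then obtain M G where M: "open M" "\<Psi> y \<in> M" "holomorphic_fun_on G M"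
    and peak: "\<And>z. z \<in> A \<inter> M - {\<Psi> y} \<Longrightarrow> cmod (G z) < cmod (G (\<Psi> y))"
    unfolding peak_at_def by blast
  have "open (V \<inter> \<Psi> -` M)"
    using holomorphic_map_on_imp_continuous_on[OF \<Psi>] \<open>open V\<close> M(1) continuous_open_preimage by blast
  then obtain r where r: "r > 0" "ball y r \<subseteq> V \<inter> \<Psi> -` M"
    using M(2) \<open>y \<in> V\<close> open_contains_ball_eq by blast
  define R where "R = r / norm v"
  have R: "R > 0" using r \<open>v \<noteq> 0\<close> by (simp add: R_def)
  have inb: "y + t *s v \<in> V \<inter> \<Psi> -` M" if "t \<in> ball 0 R" for t
  proof -
    have "y + t *s v \<in> ball y r"
      using that \<open>v \<noteq> 0\<close> by (simp add: R_def dist_norm norm_vector_scalar_mult field_simps)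
    then show ?thesis using r(2) by blast
  qed
  define \<phi> where "\<phi> t = G (\<Psi> (y + t *s v))" for t
  have less: "cmod (\<phi> t) < cmod (\<phi> 0)" if "t \<in> ball 0 R" "t \<noteq> 0" for t
  proof -
    have "y + t *s v \<noteq> y" using that \<open>v \<noteq> 0\<close> by simp
    then have "\<Psi> (y + t *s v) \<noteq> \<Psi> y"
      using inj inb[OF that(1)] \<open>y \<in> V\<close> unfolding inj_on_def by blast
    then have "cmod (G (\<Psi> (y + t *s v))) < cmod (G (\<Psi> y))"
      using peak sub inb[OF that(1)] by blast
    then show ?thesis by (simp add: \<phi>_def)
  qed
  have "\<phi> constant_on ball 0 R"
  proof (rule maximum_modulus_principle[where U = "ball 0 R" and \<xi> = 0])
    show "\<phi> holomorphic_on ball 0 R"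
      unfolding \<phi>_def
    proof (rule holomorphic_on_along_line[where f = "\<lambda>y. G (\<Psi> y)"])
      show "holomorphic_fun_on (\<lambda>y. G (\<Psi> y)) (V \<inter> \<Psi> -` M)"
        by (rule holomorphic_fun_on_compose_map[OF M(3) holomorphic_map_on_subset[OF \<Psi>]]) auto
    qed (rule inb)
    show "cmod (\<phi> t) \<le> cmod (\<phi> 0)" if "t \<in> ball 0 R" for t using less[OF that] by force
  qed (use R in auto)
  then obtain c where c: "\<And>t. t \<in> ball 0 R \<Longrightarrow> \<phi> t = c" unfolding constant_on_def by blast
  have "of_real (R / 2) \<in> ball (0::complex) R" "of_real (R / 2) \<noteq> (0::complex)" "0 \<in> ball (0::complex) R"
    using R by auto
  then show False using less c by (metis less_irrefl)
qed

lemma closedin_common_zeros: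
  assumes "\<And>f. f \<in> F \<Longrightarrow> holomorphic_fun_on f N"
  shows "closedin (top_of_set N) {z \<in> N. \<forall>f\<in>F. f z = 0}"
proof -
  have eq: "{z \<in> N. \<forall>f\<in>F. f z = 0} = \<Inter>(insert N ((\<lambda>f. {z \<in> N. f z = 0}) ` F))" by auto
  have "closedin (top_of_set N) {z \<in> N. f z = 0}" if "f \<in> F" for f
    using continuous_closedin_preimage_constant holomorphic_fun_on_imp_continuous_on[OF assms[OF that]]
    by blast
  then show ?thesis unfolding eq by (intro closedin_Inter) auto
qed

lemma not_peak_at_perfect_kernel_in_chart:
  fixes N :: "(complex ^ 'n::finite) set" and J :: "'n set"
  assumes N: "open N" and F: "finite F" "\<And>f. f \<in> F \<Longrightarrow> holomorphic_fun_on f N"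
    and C: "C = {z \<in> N. \<forall>f\<in>F. f z = 0}"
    and "q \<in> perfect_kernel C" "open U" "q \<in> U" "U \<subseteq> N" "holomorphic_map_on \<Phi> U"
      "\<And>v. jac \<Phi> q v = 0 \<Longrightarrow> v = 0"
      "\<And>z j. z \<in> perfect_kernel C \<inter> U \<Longrightarrow> j \<in> J \<Longrightarrow> \<Phi> z $ j = 0"
  shows "\<not> peak_at (perfect_kernel C) q"
  using assms(5-)
proof (induction "card (- J)" arbitrary: J q U \<Phi> rule: less_induct)
  case less
  let ?A = "perfect_kernel C"
  have closedC: "closedin (top_of_set N) C"
    unfolding C by (rule closedin_common_zeros[OF F(2)])
  note closedA = closedin_perfect_kernel[OF closedC]
  obtain U' V \<Psi> where U': "open U'" "U' \<subseteq> U" "q \<in> U'" "open V" and hom: "homeomorphism U' V \<Phi> \<Psi>"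
    and \<Psi>: "holomorphic_map_on \<Psi> V" and nd: "\<And>z v. z \<in> U' \<Longrightarrow> jac \<Phi> z v = 0 \<Longrightarrow> v = 0"
    using holomorphic_inverse_function[OF less.prems(5,2,3,6)] by metis
  have \<Phi>U': "holomorphic_map_on \<Phi> U'" using holomorphic_map_on_subset less.prems(5) U'(2) by blast
  have \<Psi>\<Phi>: "\<Psi> (\<Phi> z) = z" if "z \<in> U'" for z using hom that by (simp add: homeomorphism_def)
  note img = homeomorphism_image_open[OF hom \<open>open V\<close>]
  define D where "D v f z = frechet_derivative (\<lambda>y. f (\<Psi> y)) (at (\<Phi> z)) v"
    for v and f :: "complex ^ 'n \<Rightarrow> complex" and z
  have holc: "holomorphic_fun_on (\<lambda>y. f (\<Psi> y)) (\<Phi> ` W)"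
    if "open W" "W \<subseteq> U'" "holomorphic_fun_on f W" for f W
    using holomorphic_fun_on_compose_map[OF that(3) holomorphic_map_on_subset[OF \<Psi>]]
      img[OF that(1,2)] by blast
  have holD: "holomorphic_fun_on (D v f) W" if "open W" "W \<subseteq> U'" "holomorphic_fun_on f W" for f W v
    unfolding D_def
    by (rule holomorphic_fun_on_compose_map[OF holomorphic_fun_on_directional_derivative[OF holc[OF that] img(1)[OF that(1,2)]]
        holomorphic_map_on_subset[OF \<Phi>U' that(2)]]) auto
  show ?case
  proof (cases "\<exists>f W v. open W \<and> q \<in> W \<and> W \<subseteq> U' \<and> holomorphic_fun_on f W \<and>
      (\<forall>z \<in> ?A \<inter> W. f z = 0) \<and> (\<forall>j\<in>J. v $ j = 0) \<and> (\<forall>e>0. \<exists>x \<in> ?A \<inter> ball q e. D v f x \<noteq> 0)")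
    case True
    then obtain f W v where W: "open W" "q \<in> W" "W \<subseteq> U'" and f: "holomorphic_fun_on f W"
      "\<And>z. z \<in> ?A \<inter> W \<Longrightarrow> f z = 0" and v: "\<And>j. j \<in> J \<Longrightarrow> v $ j = 0"
      and dense: "\<And>e. e > 0 \<Longrightarrow> \<exists>x \<in> ?A \<inter> ball q e. D v f x \<noteq> 0" by metis
    show ?thesis
    proof (rule not_peak_at_if_dense[OF N closedA less.prems(1) W(1,2) holD[OF W(1,3) f(1)] dense])
      fix x assume x: "x \<in> ?A \<inter> W" "D v f x \<noteq> 0"
      have fx: "\<Phi> x \<in> \<Phi> ` W" using x by blast
      note dF = holomorphic_fun_onD[OF holc[OF W(1,3) f(1)] fx]
      obtain j where j: "v $ j \<noteq> 0" "D (axis j 1) f x \<noteq> 0"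
        using linear_eq_zero_on_axes[OF has_derivative_linear[OF dF(1)] dF(2), of v] x(2)
        unfolding D_def by blast
      have "j \<notin> J" using j(1) v by blast
      define \<Phi>' where "\<Phi>' z = (\<chi> i. if i = j then f z else \<Phi> z $ i)" for z
      have "card (- insert j J) < card (- J)"
        using \<open>j \<notin> J\<close> by (intro psubset_card_mono) auto
      moreover have "holomorphic_map_on \<Phi>' W"
        unfolding holomorphic_map_on_def
      proof
        fix i
        show "holomorphic_fun_on (\<lambda>z. \<Phi>' z $ i) W"
          using f(1) holomorphic_map_on_subset[OF \<Phi>U' W(3)]
          by (cases "i = j") (auto simp: \<Phi>'_def holomorphic_map_on_def)
      qed
      moreover have "u = 0" if u: "jac \<Phi>' x u = 0" for u
      proof -
        have xU: "x \<in> U'" using x W(3) by blast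
        have ji: "jac \<Phi> x u $ i = 0" if "i \<noteq> j" for i
        proof -
          have "jac \<Phi>' x u $ i = jac \<Phi> x u $ i" using that by (simp add: jac_def \<Phi>'_def)
          then show ?thesis using u by simp
        qed
        have "frechet_derivative f (at x) u = jac \<Phi>' x u $ j" by (simp add: jac_def \<Phi>'_def)
        then have fu: "frechet_derivative f (at x) u = 0" using u by simp
        have "((\<lambda>z. f (\<Psi> (\<Phi> z))) has_derivative
            (\<lambda>v. frechet_derivative (\<lambda>y. f (\<Psi> y)) (at (\<Phi> x)) (jac \<Phi> x v))) (at x)"
          by (rule frechet_derivative_compose_holomorphic_map[OF holc[OF W(1,3) f(1)] \<Phi>U' xU fx])
        then have "(f has_derivative
            (\<lambda>v. frechet_derivative (\<lambda>y. f (\<Psi> y)) (at (\<Phi> x)) (jac \<Phi> x v))) (at x)"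
          by (rule has_derivative_transform_within_open[OF _ \<open>open U'\<close> xU]) (simp add: \<Psi>\<Phi>)
        then have "D (jac \<Phi> x u) f x = 0"
          using fu frechet_derivative_at unfolding D_def by metis
        moreover have "jac \<Phi> x u = (jac \<Phi> x u $ j) *s axis j 1"
          using ji by (auto simp: vec_eq_iff axis_def)
        ultimately have "(jac \<Phi> x u $ j) * D (axis j 1) f x = 0"
          unfolding D_def by (metis dF(2))
        then have "jac \<Phi> x u $ j = 0" using j(2) by simp
        then have "jac \<Phi> x u = 0" using ji by (metis vec_eq_iff zero_index)
        then show "u = 0" using nd xU by blast
      qed
      moreover have "\<Phi>' z $ i = 0" if "z \<in> ?A \<inter> W" "i \<in> insert j J" for z i
        using that f(2)[OF that(1)] less.prems(7)[of z i] W(3) U'(2) by (auto simp: \<Phi>'_def)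
      ultimately show "\<not> peak_at ?A x"
        using less.hyps[of "insert j J" x W \<Phi>'] x(1) W U'(2) less.prems(4) by blast
    qed
  next
    case False
    have Dzero: "\<exists>e>0. \<forall>x \<in> ?A \<inter> ball q e. D v f x = 0"
      if "open W" "q \<in> W" "W \<subseteq> U'" "holomorphic_fun_on f W" "\<And>z. z \<in> ?A \<inter> W \<Longrightarrow> f z = 0"
        "\<And>j. j \<in> J \<Longrightarrow> v $ j = 0" for f W v
      using False that by metis
    have "\<Phi> ` U' = V" using hom by (simp add: homeomorphism_def)
    then have "\<Phi> q \<in> V" using U'(3) by blast
    then obtain \<rho> where \<rho>: "\<rho> > 0" "ball (\<Phi> q) \<rho> \<subseteq> V" using \<open>open V\<close> open_contains_ball_eq by blast
    define B where "B = {y \<in> ball (\<Phi> q) \<rho>. \<forall>j\<in>J. y $ j = 0}"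
    have \<Phi>q: "\<Phi> q $ j = 0" if "j \<in> J" for j using less.prems that by blast
    have "f (\<Psi> y) = 0" if "f \<in> F" "y \<in> B" for f y
    proof -
      define v where "v = y - \<Phi> q"
      have v: "v $ j = 0" if "j \<in> J" for j using \<open>y \<in> B\<close> that \<Phi>q by (simp add: v_def B_def)
      define fs where "fs k = (D v ^^ k) f" for k
      have holf: "holomorphic_fun_on (fs k) U'" for k
      proof (induction k)
        case 0
        show ?case using holomorphic_fun_on_subset[OF F(2)[OF \<open>f \<in> F\<close>]] U'(2) less.prems(4)
          by (auto simp: fs_def)
      next
        case (Suc k)
        then show ?case using holD[OF U'(1) subset_refl Suc] by (simp add: fs_def)
      qed
      have van: "\<exists>e>0. \<forall>x \<in> ?A \<inter> ball q e. fs k x = 0" for k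
      proof (induction k)
        case 0
        have "f x = 0" if "x \<in> ?A" for x using perfect_kernel_subset[of C] C that \<open>f \<in> F\<close> by blast
        then show ?case by (auto simp: fs_def intro!: exI[of _ 1])
      next
        case (Suc k)
        then obtain e where e: "e > 0" "\<And>x. x \<in> ?A \<inter> ball q e \<Longrightarrow> fs k x = 0" by blast
        have "\<exists>e>0. \<forall>x \<in> ?A \<inter> ball q e. D v (fs k) x = 0"
          by (rule Dzero[of "U' \<inter> ball q e"])
             (use U' e v holomorphic_fun_on_subset[OF holf] in auto)
        then show ?case by (simp add: fs_def)
      qed
      have "(\<lambda>k y. fs k (\<Psi> y)) 0 (\<Phi> q + v) = 0"
      proof (rule vanish_on_ball_if_derivatives_vanish)
        fix k
        show "holomorphic_fun_on (\<lambda>y. fs k (\<Psi> y)) (ball (\<Phi> q) \<rho>)"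
          using holc[OF U'(1) subset_refl holf] \<rho>(2) holomorphic_fun_on_subset \<open>\<Phi> ` U' = V\<close> by blast
        show "fs (Suc k) (\<Psi> y) = frechet_derivative (\<lambda>y. fs k (\<Psi> y)) (at y) v"
          if "y \<in> ball (\<Phi> q) \<rho>" for y
        proof -
          have "\<Phi> (\<Psi> y) = y" using hom that \<rho>(2) by (auto simp: homeomorphism_def)
          then show ?thesis by (simp add: fs_def D_def)
        qed
        show "fs k (\<Psi> (\<Phi> q)) = 0"
          using van[of k] less.prems(1) \<Psi>\<Phi>[OF U'(3)] by auto
        show "\<Phi> q + v \<in> ball (\<Phi> q) \<rho>" using \<open>y \<in> B\<close> by (simp add: v_def B_def)
      qed
      then show ?thesis by (simp add: fs_def v_def)
    qed
    moreover have \<Psi>B: "\<Psi> y \<in> U'" if "y \<in> B" for y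
      using hom that \<rho>(2) by (auto simp: homeomorphism_def B_def)
    ultimately have TC: "\<Psi> ` B \<subseteq> C" using C U'(2) less.prems(4) by blast
    have qB: "\<Phi> q \<in> B" using \<Phi>q \<rho>(1) by (simp add: B_def)
    have inj: "inj_on \<Psi> V" using hom by (metis homeomorphism_def inj_on_inverseI)
    have "J \<noteq> UNIV"
    proof
      assume "J = UNIV"
      have "q islimpt ?A" using islimpt_perfect_kernel less.prems(1) by blast
      then obtain x where x: "x \<in> ?A" "x \<in> U'" "x \<noteq> q"
        using U'(1,3) unfolding islimpt_def by blast
      have "\<Phi> x $ j = 0" for j using less.prems(7)[of x j] x U'(2) \<open>J = UNIV\<close> by blast
      moreover have "\<Phi> q $ j = 0" for j using \<Phi>q \<open>J = UNIV\<close> by blast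
      ultimately have "\<Phi> x = \<Phi> q" by (simp add: vec_eq_iff)
      then show False using \<Psi>\<Phi> x U'(3) by metis
    qed
    then obtain j where "j \<notin> J" by blast
    have "x islimpt \<Psi> ` B" if x: "x \<in> \<Psi> ` B" for x
      unfolding islimpt_def
    proof (intro allI impI)
      fix T assume T: "x \<in> T" "open T"
      obtain y where y: "y \<in> B" "x = \<Psi> y" using x by blast
      have "open (V \<inter> \<Psi> -` T)"
        using holomorphic_map_on_imp_continuous_on[OF \<Psi>] \<open>open V\<close> T(2) continuous_open_preimage by blast
      then have "open (ball (\<Phi> q) \<rho> \<inter> (V \<inter> \<Psi> -` T))" by blast
      moreover have yb: "y \<in> ball (\<Phi> q) \<rho>" "y \<in> V" using y \<rho>(2) by (auto simp: B_def)
      ultimately obtain d where d: "d > 0" "ball y d \<subseteq> ball (\<Phi> q) \<rho> \<inter> (V \<inter> \<Psi> -` T)"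
        using T(1) y(2) open_contains_ball_eq by blast
      define y' where "y' = y + of_real (d / 2) *s axis j 1"
      have "norm (of_real (d / 2) *s axis j 1 :: complex ^ 'n) = d / 2"
        using d by (simp add: norm_vector_scalar_mult norm_axis_1)
      then have "y' \<in> ball y d" "y' \<noteq> y" using d(1) by (auto simp: y'_def dist_norm)
      then have y': "y' \<in> ball (\<Phi> q) \<rho>" "y' \<in> V" "\<Psi> y' \<in> T" using d(2) by auto
      moreover have "y' \<in> B" using y(1) y'(1) \<open>j \<notin> J\<close> by (auto simp: B_def y'_def axis_def)
      moreover have "\<Psi> y' \<noteq> x" using inj y'(2) yb(2) \<open>y' \<noteq> y\<close> y(2) unfolding inj_on_def by blast
      ultimately show "\<exists>x'\<in>\<Psi> ` B. x' \<in> T \<and> x' \<noteq> x" by blast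
    qed
    then have TA: "\<Psi> ` B \<subseteq> ?A" using perfect_kernel_maximal[OF TC] by blast
    have "\<not> peak_at ?A (\<Psi> (\<Phi> q))"
    proof (rule not_peak_at_if_contains_slice[where \<Psi> = \<Psi> and y = "\<Phi> q" and V = "ball (\<Phi> q) \<rho>" and v = "axis j 1"])
      show "holomorphic_map_on \<Psi> (ball (\<Phi> q) \<rho>)" using \<Psi> \<rho>(2) holomorphic_map_on_subset by blast
      show "inj_on \<Psi> (ball (\<Phi> q) \<rho>)" using inj \<rho>(2) inj_on_subset by blast
      fix t assume "\<Phi> q + t *s axis j 1 \<in> ball (\<Phi> q) \<rho>"
      then have "\<Phi> q + t *s axis j 1 \<in> B"
        using \<Phi>q \<open>j \<notin> J\<close> by (auto simp: B_def axis_def)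
      then show "\<Psi> (\<Phi> q + t *s axis j 1) \<in> ?A" using TA by blast
    qed (use \<rho> in auto)
    then show ?thesis using \<Psi>\<Phi>[OF U'(3)] by simp
  qed
qed

lemma not_peak_at_perfect_kernel:
  fixes N :: "(complex ^ 'n::finite) set"
  assumes N: "open N" and F: "finite F" "\<And>f. f \<in> F \<Longrightarrow> holomorphic_fun_on f N"
    and C: "C = {z \<in> N. \<forall>f\<in>F. f z = 0}" and q: "q \<in> perfect_kernel C"
  shows "\<not> peak_at (perfect_kernel C) q"
proof (rule not_peak_at_perfect_kernel_in_chart[OF N F C q N _ subset_refl, where \<Phi> = "\<lambda>z. z" and J = "{}"])
  show "q \<in> N" using q perfect_kernel_subset[of C] C by blast
  show "holomorphic_map_on (\<lambda>z. z) N"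
    unfolding holomorphic_map_on_def by (simp add: holomorphic_fun_on_component)
  fix v :: "complex ^ 'n" assume "jac (\<lambda>z. z) q v = 0"
  moreover have "frechet_derivative (\<lambda>z :: complex ^ 'n. z $ i) (at q) v = v $ i" for i
    by (metis bounded_linear_vec_nth bounded_linear_imp_has_derivative frechet_derivative_at)
  ultimately show "v = 0" by (simp add: jac_def vec_eq_iff)
qed auto

section \<open>Zeros of polynomials near a support curve\<close>

lemma complex_regular_point_in_perfect_kernel:
  fixes q :: "complex ^ 'n::finite"
  assumes "complex_regular_point C 1 q" "open N" "q \<in> N"
  shows "q \<in> perfect_kernel (C \<inter> N)"
proof -
  obtain M S and \<Phi> \<Psi> :: "complex ^ 'n \<Rightarrow> complex ^ 'n" where M: "open M" "q \<in> M" "open (\<Phi> ` M)"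
    and \<Psi>: "holomorphic_map_on \<Psi> (\<Phi> ` M)" "\<And>z. z \<in> M \<Longrightarrow> \<Psi> (\<Phi> z) = z"
    and S: "vec.subspace S" "vec.dim S = 1" "\<Phi> ` (C \<inter> M) = S \<inter> \<Phi> ` M" and "q \<in> C"
    using assms(1) unfolding complex_regular_point_def by metis
  have "\<not> S \<subseteq> {0}" using S(2) vec.dim_eq_0 by (metis zero_neq_one)
  then obtain v where v: "v \<in> S" "v \<noteq> 0" by blast
  let ?T = "C \<inter> M \<inter> N"
  have "?T \<subseteq> perfect_kernel (C \<inter> N)"
  proof (rule perfect_kernel_maximal)
    fix x assume x: "x \<in> ?T"
    show "x islimpt ?T"
      unfolding islimpt_def
    proof (intro allI impI)
      fix T assume T: "x \<in> T" "open T"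
      have "open (\<Phi> ` M \<inter> \<Psi> -` (T \<inter> N))"
        using holomorphic_map_on_imp_continuous_on[OF \<Psi>(1)] M(3) T(2) assms(2)
          continuous_open_preimage by blast
      moreover have "\<Phi> x \<in> \<Phi> ` M \<inter> \<Psi> -` (T \<inter> N)" using x T \<Psi>(2)[of x] by auto
      ultimately obtain d where d: "d > 0" "ball (\<Phi> x) d \<subseteq> \<Phi> ` M \<inter> \<Psi> -` (T \<inter> N)"
        using open_contains_ball_eq by blast
      define t where "t = d / (2 * norm v)"
      define y where "y = \<Phi> x + of_real t *s v"
      have t: "t > 0" using d v by (simp add: t_def)
      have "norm (of_real t *s v) = t * norm v" using t by (simp add: norm_vector_scalar_mult)
      then have "norm (of_real t *s v) = d / 2" using v by (simp add: t_def)
      then have y: "y \<in> ball (\<Phi> x) d" using d(1) by (simp add: y_def dist_norm)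
      have "\<Phi> x \<in> S" using x S(3) by blast
      then have "y \<in> S" unfolding y_def by (intro vec.subspace_add[OF S(1)] vec.subspace_scale[OF S(1)] v(1))
      moreover have "y \<in> \<Phi> ` M" using y d(2) by blast
      ultimately have "y \<in> \<Phi> ` (C \<inter> M)" unfolding S(3) by simp
      then obtain z where z: "z \<in> C \<inter> M" "\<Phi> z = y" by blast
      have "\<Psi> y \<in> T \<inter> N" using y d(2) by blast
      then have "z \<in> T \<inter> N" using z \<Psi>(2)[of z] by auto
      moreover have "y \<noteq> \<Phi> x" using t v(2) by (simp add: y_def)
      then have "z \<noteq> x" using z(2) by blast
      ultimately show "\<exists>y\<in>?T. y \<in> T \<and> y \<noteq> x" using z(1) by blast
    qed
  qed auto
  then show ?thesis using \<open>q \<in> C\<close> M(2) assms(3) by blast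
qed

lemma complex_dim_at_one_in_perfect_kernel:
  assumes "complex_dim_at C p 1" "open N" "p \<in> N" "closedin (top_of_set N) (C \<inter> N)"
  shows "p \<in> perfect_kernel (C \<inter> N)"
proof -
  have "p \<in> closure (N \<inter> {q. complex_regular_point C 1 q})"
    using assms open_Int_closure_subset unfolding complex_dim_at_def by blast
  moreover have "N \<inter> {q. complex_regular_point C 1 q} \<subseteq> perfect_kernel (C \<inter> N)"
    using complex_regular_point_in_perfect_kernel assms(2) by blast
  ultimately have "p \<in> closure (perfect_kernel (C \<inter> N))" using closure_mono by blast
  then show ?thesis using closure_perfect_kernel_subset[OF assms(4)] assms(3) by blast
qed

lemma zeros_on_side_of_peak_free_set:
  fixes p :: "complex ^ 'n::finite"
  assumes A: "closedin (top_of_set N) A" "p \<in> A" and np: "\<And>q. q \<in> A \<Longrightarrow> \<not> peak_at A q"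
    and r: "r > 0" "cball p r \<subseteq> N"
    and H: "compact (H \<inter> cball p r)" "p \<in> H"
    and \<Omega>: "open (\<Omega> \<inter> ball p r)" "open (ball p r - H - \<Omega>)" "A \<inter> cball p r - {p} \<subseteq> \<Omega>" "\<Omega> \<inter> H = {}"
  obtains \<epsilon> where "\<epsilon> > 0"
    "\<And>f z. holomorphic_fun_on f UNIV \<Longrightarrow> (\<And>z. z \<in> H \<inter> cball p r \<Longrightarrow> f z \<noteq> 0) \<Longrightarrow>
      z \<in> ball p \<epsilon> \<Longrightarrow> f z = 0 \<Longrightarrow> z \<in> \<Omega>"
proof -
  define R where "R = r / 2"
  have R: "R > 0" "R < r" "cball p R \<subseteq> cball p r" using r by (auto simp: R_def)
  define X where "X = A \<inter> cball p R"
  have X: "compact X"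
    unfolding X_def by (rule compact_Int_cball_relative[OF A(1)]) (use r R in blast)
  have "compact (X \<inter> sphere p R)" using X by (simp add: compact_Int)
  moreover have "X \<inter> sphere p R \<subseteq> \<Omega> \<inter> ball p r" using \<Omega>(3) R by (auto simp: X_def)
  ultimately obtain d where d: "d > 0" "(\<Union>x\<in>X \<inter> sphere p R. ball x d) \<subseteq> \<Omega> \<inter> ball p r"
    using compact_subset_open_imp_ball_epsilon_subset[OF _ \<Omega>(1)] by metis
  define \<epsilon> where "\<epsilon> = min d (r / 2)"
  have \<epsilon>: "\<epsilon> > 0" using d r by (simp add: \<epsilon>_def)
  have shift: "x + w \<in> ball p r" if "x \<in> X" "w \<in> ball 0 \<epsilon>" for x w
  proof -
    have "dist x (x + w) < r / 2" using that by (simp add: \<epsilon>_def dist_norm)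
    moreover have "dist p x \<le> r / 2" using that by (simp add: X_def R_def)
    ultimately show ?thesis using dist_triangle[of p "x + w" x] by simp
  qed
  have sph: "x + w \<in> \<Omega>" if "x \<in> X" "x \<in> sphere p R" "w \<in> ball 0 \<epsilon>" for x w
  proof -
    have "x + w \<in> ball x d" using that by (simp add: \<epsilon>_def dist_norm)
    then show ?thesis using d(2) that by blast
  qed
  show thesis
  proof (rule that[OF \<epsilon>])
    fix f z assume f: "holomorphic_fun_on f UNIV" and f0: "\<And>z. z \<in> H \<inter> cball p r \<Longrightarrow> f z \<noteq> 0"
      and z: "z \<in> ball p \<epsilon>" "f z = 0"
    have contf: "continuous_on S f" for S
      using holomorphic_fun_on_imp_continuous_on[OF f] continuous_on_subset by blast
    have pH: "p \<in> H \<inter> cball p r" using H(2) r by simp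
    have "continuous_on (H \<inter> cball p r) (\<lambda>z. cmod (f z))" by (intro continuous_intros contf)
    then obtain b where b: "b \<in> H \<inter> cball p r" "\<And>y. y \<in> H \<inter> cball p r \<Longrightarrow> cmod (f b) \<le> cmod (f y)"
      using continuous_attains_inf[OF H(1)] pH by blast
    define \<delta> where "\<delta> = cmod (f b)"
    have \<delta>: "\<delta> > 0" "\<And>y. y \<in> H \<inter> cball p r \<Longrightarrow> \<delta> \<le> cmod (f y)"
      using b f0[OF b(1)] by (auto simp: \<delta>_def)
    define bad where "bad w \<longleftrightarrow> (\<exists>x\<in>X. x + w \<notin> \<Omega> \<and> f (x + w) = 0)" for w
    have key: "bad w" if w: "w \<in> ball 0 \<epsilon>" and x: "x \<in> X" "x + w \<notin> \<Omega>" "cmod (f (x + w)) < \<delta>" for w x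
    proof (rule ccontr)
      assume nb: "\<not> bad w"
      define Y where "Y = X - (\<lambda>x. x + w) -` (\<Omega> \<inter> ball p r)"
      have Yiff: "y \<in> Y \<longleftrightarrow> y \<in> X \<and> y + w \<notin> \<Omega>" for y using shift[OF _ w] by (auto simp: Y_def)
      have nz: "f (y + w) \<noteq> 0" if "y \<in> Y" for y using nb that by (auto simp: bad_def Yiff)
      have "open ((\<lambda>x. x + w) -` (\<Omega> \<inter> ball p r))"
        by (intro open_vimage \<Omega>(1) continuous_intros)
      then have "compact Y" unfolding Y_def by (rule compact_diff[OF X])
      define u where "u y = cmod (inverse (f (y + w)))" for y
      obtain e y where y: "e > 0" "y \<in> Y" "y \<notin> {y. \<delta> \<le> cmod (f (y + w))}" "u y > 0"
        "\<And>y'. y' \<in> Y \<Longrightarrow> u y' * exp (e * (norm y')\<^sup>2) \<le> u y * exp (e * (norm y)\<^sup>2)"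
      proof (rule perturbed_maximum[OF \<open>compact Y\<close>, of u x "inverse \<delta>" "{y. \<delta> \<le> cmod (f (y + w))}"])
        show "continuous_on Y u"
          unfolding u_def
          by (intro continuous_intros continuous_on_compose2[OF contf[of UNIV]]) (use nz in auto)
        show "x \<in> Y" using x Yiff by blast
        then have "0 < cmod (f (x + w))" using nz by simp
        then show "inverse \<delta> < u x" unfolding u_def norm_inverse by (rule less_imp_inverse_less[OF x(3)])
        show "0 \<le> inverse \<delta>" using \<delta> by simp
        show "u y \<le> inverse \<delta>" if "y \<in> Y \<inter> {y. \<delta> \<le> cmod (f (y + w))}" for y
          using that \<delta>(1) by (simp add: u_def norm_inverse le_imp_inverse_le)
      qed blast
      have yX: "y \<in> X" "y + w \<notin> \<Omega>" using y(2) Yiff by auto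
      define M where "M = ball p R \<inter> (\<lambda>y. y + w) -` ((ball p r - H - \<Omega>) \<inter> {z. f z \<noteq> 0})"
      have "open {z. f z \<noteq> 0}" using contf[of UNIV] by (intro open_Collect_neq continuous_intros)
      then have "open M"
        unfolding M_def by (intro open_Int open_vimage \<Omega>(2) open_ball continuous_intros)
      have "y + w \<notin> H" using y(3) \<delta>(2)[of "y + w"] shift[OF yX(1) w] by auto
      moreover have "y \<in> ball p R" using yX sph[OF yX(1) _ w] by (force simp: X_def)
      ultimately have "y \<in> M" using shift[OF yX(1) w] yX(2) nz[OF y(2)] by (simp add: M_def)
      have "peak_at A y"
      proof (rule peak_at_perturbed_maximum[OF \<open>open M\<close> \<open>y \<in> M\<close>, where \<epsilon> = e])
        show "holomorphic_fun_on (\<lambda>y. inverse (f (y + w))) M"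
        proof (rule holomorphic_fun_on_inverse)
          show "holomorphic_fun_on (\<lambda>y. f (y + w)) M"
            by (rule holomorphic_fun_on_translate[OF holomorphic_fun_on_subset[OF f]]) simp
        qed (simp add: M_def)
        show "inverse (f (y + w)) \<noteq> 0" using y(4) by (simp add: u_def)
        show "cmod (inverse (f (y' + w))) * exp (e * (norm y')\<^sup>2) \<le>
            cmod (inverse (f (y + w))) * exp (e * (norm y)\<^sup>2)" if "y' \<in> A \<inter> M" for y'
          using y(5)[of y'] that by (auto simp: u_def Yiff X_def M_def)
      qed (rule y)
      then show False using np yX by (simp add: X_def)
    qed
    define T where "T = {w \<in> ball 0 \<epsilon>. bad w}"
    have "open T"
    proof -
      let ?O = "\<lambda>x. ball 0 \<epsilon> \<inter> (\<lambda>w. x + w) -` ((ball p r - H - \<Omega>) \<inter> {z. cmod (f z) < \<delta>})"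
      have "T = (\<Union>x\<in>X. ?O x)"
      proof
        show "T \<subseteq> (\<Union>x\<in>X. ?O x)"
        proof
          fix w assume "w \<in> T"
          then obtain x where x: "w \<in> ball 0 \<epsilon>" "x \<in> X" "x + w \<notin> \<Omega>" "f (x + w) = 0"
            by (auto simp: T_def bad_def)
          moreover have "x + w \<notin> H" using f0[of "x + w"] x(4) shift[OF x(2,1)] by auto
          ultimately show "w \<in> (\<Union>x\<in>X. ?O x)" using shift[OF x(2,1)] \<delta>(1) by auto
        qed
        show "(\<Union>x\<in>X. ?O x) \<subseteq> T" using key by (auto simp: T_def)
      qed
      moreover have "open {z. cmod (f z) < \<delta>}"
        using contf[of UNIV] by (intro open_Collect_less continuous_intros)
      then have "open (?O x)" for x
        by (intro open_Int open_vimage \<Omega>(2) open_ball continuous_intros)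
      then have "open (\<Union>x\<in>X. ?O x)" by (rule open_UN[rule_format])
      ultimately show ?thesis by (simp only:)
    qed
    moreover have "closedin (top_of_set (ball 0 \<epsilon>)) T"
    proof -
      define Z where "Z = (X \<times> ball 0 \<epsilon>) \<inter> (\<lambda>(x, w). x + w) -` (- (\<Omega> \<inter> ball p r) \<inter> {z. f z = 0})"
      have "closed {z. f z = 0}" using contf[of UNIV] by (intro closed_Collect_eq continuous_intros)
      then have "closed (- (\<Omega> \<inter> ball p r) \<inter> {z. f z = 0})"
        using \<Omega>(1) by (intro closed_Int closed_Compl)
      then have "closed ((\<lambda>(x, w). x + w) -` (- (\<Omega> \<inter> ball p r) \<inter> {z. f z = 0}))"
        by (rule closed_vimage) (auto simp: case_prod_beta intro!: continuous_intros)
      then have "closedin (top_of_set (X \<times> ball 0 \<epsilon>)) Z"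
        unfolding Z_def by (rule closedin_closed_Int)
      then have "closedin (top_of_set (ball 0 \<epsilon>)) {w. \<exists>x. x \<in> X \<and> (x, w) \<in> Z}"
        by (rule closedin_compact_projection[OF X])
      moreover have "{w. \<exists>x. x \<in> X \<and> (x, w) \<in> Z} = T"
        using shift by (auto simp: Z_def T_def bad_def)
      ultimately show ?thesis by simp
    qed
    moreover have "0 \<notin> T"
      using f0[OF pH] \<Omega>(3) R(3) by (auto simp: T_def bad_def X_def)
    moreover have "T \<subseteq> ball 0 \<epsilon>" "0 \<in> ball (0 :: complex ^ 'n) \<epsilon>" using \<epsilon> by (auto simp: T_def)
    moreover have "openin (top_of_set (ball 0 \<epsilon>)) T"
      using \<open>open T\<close> \<open>T \<subseteq> ball 0 \<epsilon>\<close> by (simp add: open_subset)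
    ultimately have "T = {}"
      using connected_clopen[THEN iffD1, OF connected_ball[of "0 :: complex ^ 'n" \<epsilon>]] by blast
    moreover have "z - p \<in> ball 0 \<epsilon>" using z(1) by (simp add: dist_norm norm_minus_commute)
    moreover have "p \<in> X" using A(2) R(1) by (simp add: X_def)
    ultimately have "\<not> bad (z - p)" "p \<in> X" by (auto simp: T_def)
    then show "z \<in> \<Omega>" using z(2) unfolding bad_def by force
  qed
qed

lemma zeros_on_side_of_support_curve:
  fixes p :: "complex ^ 'n::finite"
  assumes C: "support_curve C H p" and "p \<in> H" and \<Omega>: "\<Omega> \<in> components (W - H)" "C \<inter> W - {p} \<subseteq> \<Omega>"
    and r: "r > 0" "cball p r \<subseteq> W" and H: "compact (H \<inter> cball p r)"
  obtains \<epsilon> where "\<epsilon> > 0"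
    "\<And>f z. holomorphic_fun_on f UNIV \<Longrightarrow> (\<And>z. z \<in> H \<inter> cball p r \<Longrightarrow> f z \<noteq> 0) \<Longrightarrow>
      z \<in> ball p \<epsilon> \<Longrightarrow> f z = 0 \<Longrightarrow> z \<in> \<Omega>"
proof -
  obtain V where V: "open V" "p \<in> V" "complex_analytic_subset C V" and dim: "complex_dim_at C p 1"
    using C unfolding support_curve_def holomorphic_curve_near_def by blast
  have "\<exists>N F. open N \<and> p \<in> N \<and> N \<subseteq> V \<and> finite F \<and> (\<forall>f\<in>F. holomorphic_fun_on f N) \<and>
      C \<inter> N = {z \<in> N. \<forall>f\<in>F. f z = 0}"
    using conjunct2[OF V(3)[unfolded complex_analytic_subset_def]] V(2) by (rule bspec)
  then obtain N F where N: "open N" "p \<in> N" and F: "finite F" "\<And>f. f \<in> F \<Longrightarrow> holomorphic_fun_on f N"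
    and CN: "C \<inter> N = {z \<in> N. \<forall>f\<in>F. f z = 0}"
    by auto
  define A where "A = perfect_kernel (C \<inter> N)"
  have closedC: "closedin (top_of_set N) (C \<inter> N)"
    unfolding CN by (rule closedin_common_zeros[OF F(2)])
  obtain d where d: "d > 0" "cball p d \<subseteq> N" using N open_contains_cball by blast
  define s where "s = min r d"
  have s: "s > 0" "cball p s \<subseteq> N" "cball p s \<subseteq> cball p r" using d r(1) by (auto simp: s_def)
  have sub: "ball p s \<subseteq> W" using s(3) r(2) ball_subset_cball by blast
  have Hs: "compact (H \<inter> cball p s)"
  proof -
    have "H \<inter> cball p s = (H \<inter> cball p r) \<inter> cball p s" using s(3) by blast
    then show ?thesis using H by (metis closed_cball compact_Int_closed)
  qed
  have nbhd: "\<exists>e>0. ball x e \<subseteq> ball p s - H \<and> (ball x e \<subseteq> \<Omega> \<or> ball x e \<inter> \<Omega> = {})"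
    if x: "x \<in> ball p s - H" for x
  proof -
    have "open (ball p s - (H \<inter> cball p s))" using Hs compact_imp_closed by blast
    moreover have "ball p s - (H \<inter> cball p s) = ball p s - H" by auto
    ultimately have "open (ball p s - H)" by simp
    then obtain e where e: "e > 0" "ball x e \<subseteq> ball p s - H"
      using x open_contains_ball_eq by blast
    then have "ball x e \<subseteq> W - H" using sub by blast
    then have "ball x e \<subseteq> \<Omega> \<or> ball x e \<inter> \<Omega> = {}"
      using components_maximal[OF \<Omega>(1) connected_ball] by blast
    then show ?thesis using e by blast
  qed
  have \<Omega>H: "\<Omega> \<inter> H = {}" using in_components_subset[OF \<Omega>(1)] by blast
  obtain \<epsilon> where \<epsilon>: "\<epsilon> > 0" "\<And>f z. holomorphic_fun_on f UNIV \<Longrightarrow> (\<And>z. z \<in> H \<inter> cball p s \<Longrightarrow> f z \<noteq> 0) \<Longrightarrow>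
      z \<in> ball p \<epsilon> \<Longrightarrow> f z = 0 \<Longrightarrow> z \<in> \<Omega>"
  proof (rule zeros_on_side_of_peak_free_set[of N A p s H \<Omega>])
    show "closedin (top_of_set N) A" unfolding A_def by (rule closedin_perfect_kernel[OF closedC])
    show "p \<in> A" unfolding A_def by (rule complex_dim_at_one_in_perfect_kernel[OF dim N closedC])
    show "\<not> peak_at A q" if "q \<in> A" for q
      unfolding A_def by (rule not_peak_at_perfect_kernel[OF N(1) F CN that[unfolded A_def]])
    show "open (\<Omega> \<inter> ball p s)"
      unfolding open_contains_ball
    proof
      fix x assume x: "x \<in> \<Omega> \<inter> ball p s"
      then obtain e where "e > 0" "ball x e \<subseteq> ball p s - H" "ball x e \<subseteq> \<Omega> \<or> ball x e \<inter> \<Omega> = {}"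
        using nbhd[of x] \<Omega>H by blast
      moreover have "x \<in> ball x e" using \<open>e > 0\<close> by simp
      ultimately show "\<exists>e>0. ball x e \<subseteq> \<Omega> \<inter> ball p s" using x by blast
    qed
    show "open (ball p s - H - \<Omega>)"
      unfolding open_contains_ball
    proof
      fix x assume x: "x \<in> ball p s - H - \<Omega>"
      then obtain e where "e > 0" "ball x e \<subseteq> ball p s - H" "ball x e \<subseteq> \<Omega> \<or> ball x e \<inter> \<Omega> = {}"
        using nbhd[of x] by blast
      moreover have "x \<in> ball x e" using \<open>e > 0\<close> by simp
      ultimately show "\<exists>e>0. ball x e \<subseteq> ball p s - H - \<Omega>" using x by blast
    qed
    show "A \<inter> cball p s - {p} \<subseteq> \<Omega>"
      using \<Omega>(2) s(3) r(2) perfect_kernel_subset[of "C \<inter> N"] unfolding A_def by blast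
  qed (use s Hs \<Omega>H \<open>p \<in> H\<close> in auto)
  show thesis
  proof (rule that[OF \<epsilon>(1)])
    fix f z assume "holomorphic_fun_on f UNIV" "\<And>z. z \<in> H \<inter> cball p r \<Longrightarrow> f z \<noteq> 0"
      "z \<in> ball p \<epsilon>" "f z = 0"
    then show "z \<in> \<Omega>" using \<epsilon>(2)[of f z] s(3) by blast
  qed
qed

lemma rational_hull_subset_polynomial_hull:
  assumes "compact K"
  shows "rational_hull K \<subseteq> polynomial_hull K"
proof
  fix z assume z: "z \<in> rational_hull K"
  show "z \<in> polynomial_hull K"
    unfolding polynomial_hull_def
  proof (intro CollectI allI impI)
    fix f :: "complex ^ 'a \<Rightarrow> complex" assume f: "holomorphic_polynomial f"
    then obtain w where w: "w \<in> K" "f z = f w" using z unfolding rational_hull_def by blast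
    have "continuous_on K (\<lambda>w. cmod (f w))"
      using holomorphic_fun_on_imp_continuous_on[OF holomorphic_polynomial_imp_holomorphic_fun_on[OF f]]
      by (intro continuous_intros)
    then have "bdd_above ((\<lambda>w. cmod (f w)) ` K)"
      by (intro bounded_imp_bdd_above compact_imp_bounded compact_continuous_image assms)
    then show "cmod (f z) \<le> (SUP w\<in>K. cmod (f w))" using w by (auto intro: cSUP_upper)
  qed
qed

theorem proposition1p2:
  fixes U H K :: "(complex ^ 'n::finite) set" and p :: "complex ^ 'n"
  assumes "open U"
    and "real_analytic_hypersurface U H"
    and "closedin (top_of_set U) H"
    and "p \<in> H"
    and "curve_supported_from_two_sides H p"
    and "compact K" and "K \<subseteq> H"
    and "\<exists>T. openin (top_of_set H) T \<and> p \<in> T \<and> T \<subseteq> K"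
  shows "p \<in> interior (polynomial_hull K) \<and> p \<in> interior (rational_hull K)"
proof -
  obtain C\<^sub>1 C\<^sub>2 W \<Omega>\<^sub>1 \<Omega>\<^sub>2 where C: "support_curve C\<^sub>1 H p" "support_curve C\<^sub>2 H p" and "p \<in> interior W"
    and \<Omega>: "\<Omega>\<^sub>1 \<in> components (W - H)" "\<Omega>\<^sub>2 \<in> components (W - H)" "\<Omega>\<^sub>1 \<noteq> \<Omega>\<^sub>2"
      "C\<^sub>1 \<inter> W - {p} \<subseteq> \<Omega>\<^sub>1" "C\<^sub>2 \<inter> W - {p} \<subseteq> \<Omega>\<^sub>2"
    using assms(5) unfolding curve_supported_from_two_sides_def by blast
  obtain G where G: "open G" "p \<in> G" "H \<inter> G \<subseteq> K"
    using assms(8) unfolding openin_open by blast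
  have "open (G \<inter> interior W)" "p \<in> G \<inter> interior W" using G \<open>p \<in> interior W\<close> by auto
  then obtain r where r: "r > 0" "cball p r \<subseteq> G \<inter> interior W" using open_contains_cball by blast
  have rW: "cball p r \<subseteq> W" using r(2) interior_subset by blast
  have HK: "H \<inter> cball p r = K \<inter> cball p r" using G(3) r(2) assms(7) by blast
  then have cH: "compact (H \<inter> cball p r)" using assms(6) by (simp add: compact_Int)
  obtain \<epsilon>\<^sub>1 where \<epsilon>\<^sub>1: "\<epsilon>\<^sub>1 > 0" "\<And>f z. holomorphic_fun_on f UNIV \<Longrightarrow>
      (\<And>z. z \<in> H \<inter> cball p r \<Longrightarrow> f z \<noteq> 0) \<Longrightarrow> z \<in> ball p \<epsilon>\<^sub>1 \<Longrightarrow> f z = 0 \<Longrightarrow> z \<in> \<Omega>\<^sub>1"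
    using zeros_on_side_of_support_curve[OF C(1) assms(4) \<Omega>(1,4) r(1) rW cH] by blast
  obtain \<epsilon>\<^sub>2 where \<epsilon>\<^sub>2: "\<epsilon>\<^sub>2 > 0" "\<And>f z. holomorphic_fun_on f UNIV \<Longrightarrow>
      (\<And>z. z \<in> H \<inter> cball p r \<Longrightarrow> f z \<noteq> 0) \<Longrightarrow> z \<in> ball p \<epsilon>\<^sub>2 \<Longrightarrow> f z = 0 \<Longrightarrow> z \<in> \<Omega>\<^sub>2"
    using zeros_on_side_of_support_curve[OF C(2) assms(4) \<Omega>(2,5) r(1) rW cH] by blast
  have "z \<in> rational_hull K" if z: "z \<in> ball p (min \<epsilon>\<^sub>1 \<epsilon>\<^sub>2)" for z
    unfolding rational_hull_def
  proof (intro CollectI allI impI, rule ccontr)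
    fix f :: "complex ^ 'n \<Rightarrow> complex" assume f: "holomorphic_polynomial f" and nf: "f z \<notin> f ` K"
    let ?g = "\<lambda>x. f x - f z"
    have g: "holomorphic_fun_on ?g UNIV"
      by (rule holomorphic_fun_on_diff[OF holomorphic_polynomial_imp_holomorphic_fun_on[OF f]
            holomorphic_fun_on_const])
    have gK: "?g x \<noteq> 0" if "x \<in> H \<inter> cball p r" for x
    proof
      assume "?g x = 0"
      then have "f z = f x" by simp
      moreover have "x \<in> K" using that HK by blast
      ultimately show False using nf by blast
    qed
    have "z \<in> \<Omega>\<^sub>1" by (rule \<epsilon>\<^sub>1(2)[OF g gK]) (use z in auto)
    moreover have "z \<in> \<Omega>\<^sub>2" by (rule \<epsilon>\<^sub>2(2)[OF g gK]) (use z in auto)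
    ultimately show False using components_nonoverlap[OF \<Omega>(1,2)] \<Omega>(3) by blast
  qed
  then have "ball p (min \<epsilon>\<^sub>1 \<epsilon>\<^sub>2) \<subseteq> rational_hull K" by blast
  moreover have "min \<epsilon>\<^sub>1 \<epsilon>\<^sub>2 > 0" using \<epsilon>\<^sub>1 \<epsilon>\<^sub>2 by simp
  ultimately have "p \<in> interior (rational_hull K)" using mem_interior by blast
  moreover have "interior (rational_hull K) \<subseteq> interior (polynomial_hull K)"
    by (rule interior_mono[OF rational_hull_subset_polynomial_hull[OF assms(6)]])
  ultimately show ?thesis by blast
qed

end
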